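(* Let $X$ be a topological space, $\mathcal{A}$ a sheaf of $\mathbb{C}$-algebras on $X$, and let $\mathcal{F}$ and $\mathcal{E}$ be $\mathcal{A}$-modules on $X$ paired into $\mathcal{A}$. Assume that the left kernel of the pairing vanishes, $\mathcal{E}^\perp=0$. Let $\mathcal{F}_0$ be a sub-$\mathcal{A}$-module of $\mathcal{F}$ and $\mathcal{E}_0$ a sub-$\mathcal{A}$-module of $\mathcal{E}$. Then there exist natural $\mathcal{A}$-isomorphisms into (i.e. injective $\mathcal{A}$-morphisms) $$\mathcal{E}/\mathcal{F}_0^\perp\longrightarrow \mathcal{F}_0^\ast \qquad\text{and}\qquad \mathcal{E}_0^\perp\longrightarrow (\mathcal{E}/\mathcal{E}_0)^\ast .$$
   Context: As usual in abstract differential geometry, $\mathcal{A}$ is a sheaf of unital commutative $\mathbb{C}$-algebras on $X$; the pair $(X,\mathcal{A})$ is called a $\mathbb{C}$-algebraized space. An $\mathcal{A}$-module is a sheaf of $\mathcal{A}$-modules on $X$; a sub-$\mathcal{A}$-module is a subsheaf of $\mathcal{A}$-modules. For a sheaf $\mathcal{E}$, $\mathcal{E}(U)=\Gamma(U,\mathcal{E})$ and $\Gamma(\mathcal{E})$ is its (complete) presheaf of sections. The quotient $\mathcal{E}/\mathcal{G}$ is the sheaf generated by the presheaf $U\mapsto \mathcal{E}(U)/\mathcal{G}(U)$. The dual is $\mathcal{E}^\ast=\mathcal{H}om_{\mathcal{A}}(\mathcal{E},\mathcal{A})$, so $\mathcal{E}^\ast(U)=\mathrm{Hom}_{\mathcal{A}|_U}(\mathcal{E}|_U,\mathcal{A}|_U)$.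 Pairing: $\mathcal{F}$ and $\mathcal{E}$ are paired into $\mathcal{A}$ if there is given a bilinear morphism of presheaves $\vartheta=(\vartheta_U)$, with $\vartheta_U:\mathcal{F}(U)\times\mathcal{E}(U)\to\mathcal{A}(U)$ being $\mathcal{A}(U)$-bilinear and compatible with restrictions. One writes $ts:=\vartheta_U(t,s)$ for $t\in\mathcal{F}(U)$, $s\in\mathcal{E}(U)$. Orthogonals: for a sub-$\mathcal{A}$-module $\mathcal{F}_0\subseteq\mathcal{F}$ and open $U\subseteq X$, $\mathcal{F}_0(U)^\perp=\{s\in\mathcal{E}(U): ts=0 \text{ for all } t\in\mathcal{F}_0(U)\}$; for a sub-$\mathcal{A}$-module $\mathcal{E}_0\subseteq\mathcal{E}$, $\mathcal{E}_0(U)^\perp=\{t\in\mathcal{F}(U): ts=0\text{ for all } s\in\mathcal{E}_0(U)\}$. The orthogonal sub-$\mathcal{A}$-module $\mathcal{F}_0^\perp\subseteq\mathcal{E}$ (resp. $\mathcal{E}_0^\perp\subseteq\mathcal{F}$) is the sheaf generated by the presheaf $U\mapsto\mathcal{F}_0(U)^\perp$ (resp. $U\mapsto\mathcal{E}_0(U)^\perp$), with restriction maps those of $\mathcal{E}$ (resp. $\mathcal{F}$) restricted; these presheaves are taken to be complete, so that $\mathcal{F}_0^\perp(U)=\mathcal{F}_0(U)^\perp$ and $\mathcal{E}_0^\perp(U)=\mathcal{E}_0(U)^\perp$. The left kernel of the pairing is $\mathcal{E}^\perp\subseteq\mathcal{F}$ (take $\mathcal{E}_0=\mathcal{E}$);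 the right kernel is $\mathcal{F}^\perp\subseteq\mathcal{E}$. "Natural" means induced by the pairing: the two morphisms come from the pairings of $\mathcal{F}_0$ with $\mathcal{E}/\mathcal{F}_0^\perp$ and of $\mathcal{E}_0^\perp$ with $\mathcal{E}/\mathcal{E}_0$ into $\mathcal{A}$ given at the presheaf level by $t\cdot(s+\mathcal{F}_0^\perp(U))=ts$ for $t\in\mathcal{F}_0(U)$, $s\in\mathcal{E}(U)$, and $t\cdot(s+\mathcal{E}_0(U))=ts$ for $t\in\mathcal{E}_0^\perp(U)$, $s\in\mathcal{E}(U)$. *)

theory Defs
  imports "HOL-Analysis.Abstract_Topology" "HOL-Algebra.Algebra"
begin

text \<open>
  A presheaf assigns to each open set a \<^typ>\<open>('r, 'm) module\<close> record, with scalars of type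
  \<^typ>\<open>'r\<close>. The same type serves sheaves of algebras (\<^typ>\<open>'r\<close> = \<^typ>\<open>complex\<close>), where the ring
  fields are used too, and sheaves of modules, where the fields \<^const>\<open>monoid.mult\<close> and \<^const>\<open>one\<close>
  carry no meaning. Values at sets that are not open are irrelevant.
\<close>

record ('x, 'r, 'm) presheaf_data =
  sections :: "'x set \<Rightarrow> ('r, 'm) module"
  restr :: "'x set \<Rightarrow> 'x set \<Rightarrow> 'm \<Rightarrow> 'm"

locale presheaf =
  fixes T :: "'x topology" and P :: "('x, 'r, 'm) presheaf_data"
  assumes restr_closed:
      "\<lbrakk>openin T U; openin T V; V \<subseteq> U; s \<in> carrier (sections P U)\<rbrakk>
        \<Longrightarrow> restr P U V s \<in> carrier (sections P V)"
    and restr_id: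
      "\<lbrakk>openin T U; s \<in> carrier (sections P U)\<rbrakk> \<Longrightarrow> restr P U U s = s"
    and restr_restr:
      "\<lbrakk>openin T U; openin T V; openin T W; W \<subseteq> V; V \<subseteq> U; s \<in> carrier (sections P U)\<rbrakk>
        \<Longrightarrow> restr P V W (restr P U V s) = restr P U W s"

text \<open>
  Sheaves are the complete presheaves. The empty cover is allowed, so there is exactly one
  section over the empty set.
\<close>

locale sheaf = presheaf +
  assumes locality:
      "\<lbrakk>\<And>V. V \<in> \<U> \<Longrightarrow> openin T V; s \<in> carrier (sections P (\<Union>\<U>)); t \<in> carrier (sections P (\<Union>\<U>));
        \<And>V. V \<in> \<U> \<Longrightarrow> restr P (\<Union>\<U>) V s = restr P (\<Union>\<U>) V t\<rbrakk> \<Longrightarrow> s = t"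
    and gluing:
      "\<lbrakk>\<And>V. V \<in> \<U> \<Longrightarrow> openin T V; \<And>V. V \<in> \<U> \<Longrightarrow> f V \<in> carrier (sections P V);
        \<And>V W. V \<in> \<U> \<Longrightarrow> W \<in> \<U> \<Longrightarrow> restr P V (V \<inter> W) (f V) = restr P W (V \<inter> W) (f W)\<rbrakk>
        \<Longrightarrow> \<exists>s \<in> carrier (sections P (\<Union>\<U>)). \<forall>V\<in>\<U>. restr P (\<Union>\<U>) V s = f V"

locale algebra_sheaf = sheaf T A
  for T :: "'x topology" and A :: "('x, complex, 'a) presheaf_data" +
  assumes algebra_sections:
      "openin T U \<Longrightarrow> algebra (ring_of_type_algebra :: complex ring) (sections A U)"
    and restr_ring_hom:
      "\<lbrakk>openin T U; openin T V; V \<subseteq> U\<rbrakk> \<Longrightarrow> restr A U V \<in> ring_hom (sections A U) (sections A V)"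
    and restr_scalar:
      "\<lbrakk>openin T U; openin T V; V \<subseteq> U; a \<in> carrier (sections A U)\<rbrakk>
        \<Longrightarrow> restr A U V (c \<odot>\<^bsub>sections A U\<^esub> a) = c \<odot>\<^bsub>sections A V\<^esub> restr A U V a"

locale module_sheaf = A: algebra_sheaf T A + sheaf T E
  for T :: "'x topology" and A :: "('x, complex, 'a) presheaf_data"
    and E :: "('x, 'a, 'e) presheaf_data" +
  assumes module_sections:
      "openin T U \<Longrightarrow> module (sections A U) (sections E U)"
    and restr_add:
      "\<lbrakk>openin T U; openin T V; V \<subseteq> U; s \<in> carrier (sections E U); t \<in> carrier (sections E U)\<rbrakk>
        \<Longrightarrow> restr E U V (s \<oplus>\<^bsub>sections E U\<^esub> t) = restr E U V s \<oplus>\<^bsub>sections E V\<^esub> restr E U V t"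
    and restr_smult:
      "\<lbrakk>openin T U; openin T V; V \<subseteq> U; a \<in> carrier (sections A U); s \<in> carrier (sections E U)\<rbrakk>
        \<Longrightarrow> restr E U V (a \<odot>\<^bsub>sections E U\<^esub> s) = restr A U V a \<odot>\<^bsub>sections E V\<^esub> restr E U V s"

definition subpresheaf ::
    "('x, 'r, 'm) presheaf_data \<Rightarrow> ('x set \<Rightarrow> 'm set) \<Rightarrow> ('x, 'r, 'm) presheaf_data" where
  "subpresheaf E N = E\<lparr>sections := (\<lambda>U. (sections E U)\<lparr>carrier := N U\<rparr>)\<rparr>"

locale submodule_sheaf = module_sheaf T A E + sub: sheaf T "subpresheaf E N"
  for T :: "'x topology" and A :: "('x, complex, 'a) presheaf_data"
    and E :: "('x, 'a, 'e) presheaf_data" and N :: "'x set \<Rightarrow> 'e set" +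
  assumes submodule_sections:
      "openin T U \<Longrightarrow> submodule (N U) (sections A U) (sections E U)"

definition regular_sheaf ::
    "('x, complex, 'a) presheaf_data \<Rightarrow> ('x, 'a, 'a) presheaf_data" where
  \<comment> \<open>a sheaf of algebras as a sheaf of modules over itself\<close>
  "regular_sheaf A = \<lparr>
     sections = (\<lambda>U. \<lparr>carrier = carrier (sections A U), monoid.mult = monoid.mult (sections A U),
       one = one (sections A U), ring.zero = ring.zero (sections A U), add = add (sections A U),
       smult = monoid.mult (sections A U)\<rparr>),
     restr = restr A\<rparr>"


section \<open>Morphisms and the dual\<close>

definition sheaf_morphism ::
    "'x topology \<Rightarrow> ('x, complex, 'a) presheaf_data \<Rightarrow> ('x, 'a, 'e) presheaf_data
      \<Rightarrow> ('x, 'a, 'g) presheaf_data \<Rightarrow> ('x set \<Rightarrow> 'e \<Rightarrow> 'g) \<Rightarrow> bool" where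
  "sheaf_morphism T A E G \<phi> \<longleftrightarrow>
    (\<forall>U. openin T U \<longrightarrow>
      \<phi> U \<in> carrier (sections E U) \<rightarrow> carrier (sections G U) \<and>
      (\<forall>s\<in>carrier (sections E U). \<forall>t\<in>carrier (sections E U).
        \<phi> U (s \<oplus>\<^bsub>sections E U\<^esub> t) = \<phi> U s \<oplus>\<^bsub>sections G U\<^esub> \<phi> U t) \<and>
      (\<forall>a\<in>carrier (sections A U). \<forall>s\<in>carrier (sections E U).
        \<phi> U (a \<odot>\<^bsub>sections E U\<^esub> s) = a \<odot>\<^bsub>sections G U\<^esub> \<phi> U s)) \<and>
    (\<forall>U V. openin T U \<and> openin T V \<and> V \<subseteq> U \<longrightarrow>
      (\<forall>s\<in>carrier (sections E U). \<phi> V (restr E U V s) = restr G U V (\<phi> U s)))"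

definition injective_sheaf_morphism ::
    "'x topology \<Rightarrow> ('x, complex, 'a) presheaf_data \<Rightarrow> ('x, 'a, 'e) presheaf_data
      \<Rightarrow> ('x, 'a, 'g) presheaf_data \<Rightarrow> ('x set \<Rightarrow> 'e \<Rightarrow> 'g) \<Rightarrow> bool" where
  "injective_sheaf_morphism T A E G \<phi> \<longleftrightarrow>
    sheaf_morphism T A E G \<phi> \<and>
    (\<forall>U. openin T U \<longrightarrow> inj_on (\<phi> U) (carrier (sections E U)))"

text \<open>
  A section of the sheaf of homomorphisms over \<open>U\<close> is a morphism between the restrictions of the
  sheaves to the subspace \<open>U\<close>. So that equal morphisms are equal as HOL functions, it is
  required to be undefined off the open subsets of \<open>U\<close> and off the carriers.
\<close>

definition hom_sheaf ::
    "'x topology \<Rightarrow> ('x, complex, 'a) presheaf_data \<Rightarrow> ('x, 'a, 'e) presheaf_data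
      \<Rightarrow> ('x, 'a, 'g) presheaf_data \<Rightarrow> ('x, 'a, 'x set \<Rightarrow> 'e \<Rightarrow> 'g) presheaf_data" where
  "hom_sheaf T A E G = \<lparr>
     sections = (\<lambda>U. \<lparr>
       carrier = {\<phi>. sheaf_morphism (subtopology T U) A E G \<phi> \<and>
         \<phi> \<in> (\<Pi>\<^sub>E V\<in>{V. openin (subtopology T U) V}.
               carrier (sections E V) \<rightarrow>\<^sub>E carrier (sections G V))},
       monoid.mult = undefined, one = undefined,
       ring.zero = (\<lambda>V\<in>{V. openin (subtopology T U) V}. \<lambda>s\<in>carrier (sections E V). \<zero>\<^bsub>sections G V\<^esub>),
       add = (\<lambda>\<phi> \<psi>. \<lambda>V\<in>{V. openin (subtopology T U) V}. \<lambda>s\<in>carrier (sections E V).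
         \<phi> V s \<oplus>\<^bsub>sections G V\<^esub> \<psi> V s),
       smult = (\<lambda>a \<phi>. \<lambda>V\<in>{V. openin (subtopology T U) V}. \<lambda>s\<in>carrier (sections E V).
         restr A U V a \<odot>\<^bsub>sections G V\<^esub> \<phi> V s)\<rparr>),
     restr = (\<lambda>U V \<phi>. restrict \<phi> {W. openin (subtopology T V) W})\<rparr>"

definition dual_sheaf ::
    "'x topology \<Rightarrow> ('x, complex, 'a) presheaf_data \<Rightarrow> ('x, 'a, 'e) presheaf_data
      \<Rightarrow> ('x, 'a, 'x set \<Rightarrow> 'e \<Rightarrow> 'a) presheaf_data" where
  "dual_sheaf T A E = hom_sheaf T A E (regular_sheaf A)"


section \<open>Sheaf generated by a presheaf; quotients\<close>

definition germ ::
    "'x topology \<Rightarrow> ('x, 'r, 'm) presheaf_data \<Rightarrow> 'x set \<Rightarrow> 'm \<Rightarrow> 'x \<Rightarrow> ('x set \<times> 'm) set" where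
  "germ T P U s x = {(V, t). openin T V \<and> x \<in> V \<and> t \<in> carrier (sections P V) \<and>
     (\<exists>W. openin T W \<and> x \<in> W \<and> W \<subseteq> U \<inter> V \<and> restr P U W s = restr P V W t)}"

text \<open>
  Sections of the generated sheaf are the maps into the germs that locally come from sections of
  the presheaf (the continuous sections of its sheaf space). The module operations are those of
  the stalks, written as unions over all representatives of the germs involved: every choice of
  representatives contributes the same germ.
\<close>

definition generated_sheaf ::
    "'x topology \<Rightarrow> ('x, complex, 'a) presheaf_data \<Rightarrow> ('x, 'a, 'm) presheaf_data
      \<Rightarrow> ('x, 'a, 'x \<Rightarrow> ('x set \<times> 'm) set) presheaf_data" where
  "generated_sheaf T A P = \<lparr>
     sections = (\<lambda>U. \<lparr>
       carrier = {\<sigma> \<in> extensional U.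
         \<forall>x\<in>U. \<exists>V s. openin T V \<and> x \<in> V \<and> V \<subseteq> U \<and> s \<in> carrier (sections P V) \<and>
           (\<forall>y\<in>V. \<sigma> y = germ T P V s y)},
       monoid.mult = undefined, one = undefined,
       ring.zero = (\<lambda>x\<in>U. germ T P U \<zero>\<^bsub>sections P U\<^esub> x),
       add = (\<lambda>\<sigma> \<tau>. \<lambda>x\<in>U. \<Union>(V, s)\<in>\<sigma> x. \<Union>(W, t)\<in>\<tau> x.
         germ T P (V \<inter> W)
           (restr P V (V \<inter> W) s \<oplus>\<^bsub>sections P (V \<inter> W)\<^esub> restr P W (V \<inter> W) t) x),
       smult = (\<lambda>a \<sigma>. \<lambda>x\<in>U. \<Union>(V, s)\<in>\<sigma> x.
         germ T P (U \<inter> V)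
           (restr A U (U \<inter> V) a \<odot>\<^bsub>sections P (U \<inter> V)\<^esub> restr P V (U \<inter> V) s) x)\<rparr>),
     restr = (\<lambda>U V \<sigma>. restrict \<sigma> V)\<rparr>"

definition quotient_module :: "('a, 'm) module \<Rightarrow> 'm set \<Rightarrow> ('a, 'm set) module" where
  "quotient_module M N = \<lparr>carrier = a_rcosets\<^bsub>M\<^esub> N, monoid.mult = undefined, one = undefined,
     ring.zero = N, add = set_add M, smult = (\<lambda>a C. \<Union>s\<in>C. N +>\<^bsub>M\<^esub> (a \<odot>\<^bsub>M\<^esub> s))\<rparr>"

definition quotient_presheaf ::
    "('x, 'a, 'e) presheaf_data \<Rightarrow> ('x set \<Rightarrow> 'e set) \<Rightarrow> ('x, 'a, 'e set) presheaf_data" where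
  "quotient_presheaf E N = \<lparr>
     sections = (\<lambda>U. quotient_module (sections E U) (N U)),
     restr = (\<lambda>U V C. \<Union>s\<in>C. N V +>\<^bsub>sections E V\<^esub> restr E U V s)\<rparr>"

definition quotient_sheaf ::
    "'x topology \<Rightarrow> ('x, complex, 'a) presheaf_data \<Rightarrow> ('x, 'a, 'e) presheaf_data
      \<Rightarrow> ('x set \<Rightarrow> 'e set) \<Rightarrow> ('x, 'a, 'x \<Rightarrow> ('x set \<times> 'e set) set) presheaf_data" where
  "quotient_sheaf T A E N = generated_sheaf T A (quotient_presheaf E N)"

definition quotient_section ::
    "'x topology \<Rightarrow> ('x, 'a, 'e) presheaf_data \<Rightarrow> ('x set \<Rightarrow> 'e set) \<Rightarrow> 'x set \<Rightarrow> 'e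
      \<Rightarrow> 'x \<Rightarrow> ('x set \<times> 'e set) set" where
  \<comment> \<open>the section of the quotient sheaf over \<open>U\<close> given by the coset of \<open>s\<close>\<close>
  "quotient_section T E N U s =
    (\<lambda>x\<in>U. germ T (quotient_presheaf E N) U (N U +>\<^bsub>sections E U\<^esub> s) x)"


section \<open>Pairings and orthogonals\<close>

locale sheaf_pairing =
  fixes T :: "'x topology" and A :: "('x, complex, 'a) presheaf_data"
    and F :: "('x, 'a, 'f) presheaf_data" and E :: "('x, 'a, 'e) presheaf_data"
    and \<theta> :: "'x set \<Rightarrow> 'f \<Rightarrow> 'e \<Rightarrow> 'a"
  assumes pairing_closed:
      "\<lbrakk>openin T U; t \<in> carrier (sections F U); s \<in> carrier (sections E U)\<rbrakk>
        \<Longrightarrow> \<theta> U t s \<in> carrier (sections A U)"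
    and pairing_add_left:
      "\<lbrakk>openin T U; t \<in> carrier (sections F U); t' \<in> carrier (sections F U);
        s \<in> carrier (sections E U)\<rbrakk>
        \<Longrightarrow> \<theta> U (t \<oplus>\<^bsub>sections F U\<^esub> t') s = \<theta> U t s \<oplus>\<^bsub>sections A U\<^esub> \<theta> U t' s"
    and pairing_smult_left:
      "\<lbrakk>openin T U; a \<in> carrier (sections A U); t \<in> carrier (sections F U);
        s \<in> carrier (sections E U)\<rbrakk>
        \<Longrightarrow> \<theta> U (a \<odot>\<^bsub>sections F U\<^esub> t) s = a \<otimes>\<^bsub>sections A U\<^esub> \<theta> U t s"
    and pairing_add_right:
      "\<lbrakk>openin T U; t \<in> carrier (sections F U); s \<in> carrier (sections E U);
        s' \<in> carrier (sections E U)\<rbrakk>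
        \<Longrightarrow> \<theta> U t (s \<oplus>\<^bsub>sections E U\<^esub> s') = \<theta> U t s \<oplus>\<^bsub>sections A U\<^esub> \<theta> U t s'"
    and pairing_smult_right:
      "\<lbrakk>openin T U; a \<in> carrier (sections A U); t \<in> carrier (sections F U);
        s \<in> carrier (sections E U)\<rbrakk>
        \<Longrightarrow> \<theta> U t (a \<odot>\<^bsub>sections E U\<^esub> s) = a \<otimes>\<^bsub>sections A U\<^esub> \<theta> U t s"
    and pairing_restr:
      "\<lbrakk>openin T U; openin T V; V \<subseteq> U; t \<in> carrier (sections F U); s \<in> carrier (sections E U)\<rbrakk>
        \<Longrightarrow> restr A U V (\<theta> U t s) = \<theta> V (restr F U V t) (restr E U V s)"

definition orthogonal_in_right ::
    "('x, complex, 'a) presheaf_data \<Rightarrow> ('x, 'a, 'e) presheaf_data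
      \<Rightarrow> ('x set \<Rightarrow> 'f \<Rightarrow> 'e \<Rightarrow> 'a) \<Rightarrow> ('x set \<Rightarrow> 'f set) \<Rightarrow> 'x set \<Rightarrow> 'e set" where
  "orthogonal_in_right A E \<theta> F\<^sub>0 U =
    {s \<in> carrier (sections E U). \<forall>t\<in>F\<^sub>0 U. \<theta> U t s = \<zero>\<^bsub>sections A U\<^esub>}"

definition orthogonal_in_left ::
    "('x, complex, 'a) presheaf_data \<Rightarrow> ('x, 'a, 'f) presheaf_data
      \<Rightarrow> ('x set \<Rightarrow> 'f \<Rightarrow> 'e \<Rightarrow> 'a) \<Rightarrow> ('x set \<Rightarrow> 'e set) \<Rightarrow> 'x set \<Rightarrow> 'f set" where
  "orthogonal_in_left A F \<theta> E\<^sub>0 U =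
    {t \<in> carrier (sections F U). \<forall>s\<in>E\<^sub>0 U. \<theta> U t s = \<zero>\<^bsub>sections A U\<^esub>}"

definition left_kernel ::
    "('x, complex, 'a) presheaf_data \<Rightarrow> ('x, 'a, 'f) presheaf_data
      \<Rightarrow> ('x, 'a, 'e) presheaf_data \<Rightarrow> ('x set \<Rightarrow> 'f \<Rightarrow> 'e \<Rightarrow> 'a) \<Rightarrow> 'x set \<Rightarrow> 'f set" where
  "left_kernel A F E \<theta> = orthogonal_in_left A F \<theta> (\<lambda>U. carrier (sections E U))"

text \<open>
  The two maps a pairing induces: \<open>s \<mapsto> (t \<mapsto> ts)\<close> from the right module to the dual of the left
  one, and \<open>t \<mapsto> (s \<mapsto> ts)\<close> from the left module to the dual of the right one.
\<close>

definition right_to_dual ::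
    "'x topology \<Rightarrow> ('x, 'a, 'f) presheaf_data \<Rightarrow> ('x, 'a, 'e) presheaf_data
      \<Rightarrow> ('x set \<Rightarrow> 'f \<Rightarrow> 'e \<Rightarrow> 'a) \<Rightarrow> 'x set \<Rightarrow> 'e \<Rightarrow> 'x set \<Rightarrow> 'f \<Rightarrow> 'a" where
  "right_to_dual T F E \<theta> U s =
    (\<lambda>V\<in>{V. openin (subtopology T U) V}. \<lambda>t\<in>carrier (sections F V). \<theta> V t (restr E U V s))"

definition left_to_dual ::
    "'x topology \<Rightarrow> ('x, 'a, 'f) presheaf_data \<Rightarrow> ('x, 'a, 'e) presheaf_data
      \<Rightarrow> ('x set \<Rightarrow> 'f \<Rightarrow> 'e \<Rightarrow> 'a) \<Rightarrow> 'x set \<Rightarrow> 'f \<Rightarrow> 'x set \<Rightarrow> 'e \<Rightarrow> 'a" where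
  "left_to_dual T F E \<theta> U t =
    (\<lambda>V\<in>{V. openin (subtopology T U) V}. \<lambda>s\<in>carrier (sections E V). \<theta> V (restr F U V t) s)"

end

theory Submission
  imports Defs
begin

text \<open>
  The pairing descends to quotients, and injectivity of the two induced maps is then immediate.

  Suppose \<open>M \<subseteq> F\<close> and \<open>N \<subseteq> E\<close> are subsheaves of modules with \<open>ts = 0\<close> for \<open>t\<close> in \<open>M\<close> and \<open>s\<close> in \<open>N\<close>
  over every open set. Both halves of the theorem are of this kind: \<open>(M, N)\<close> is \<open>(F\<^sub>0, F\<^sub>0\<^sup>\<bottom>)\<close> in the
  first and \<open>(E\<^sub>0\<^sup>\<bottom>, E\<^sub>0)\<close> in the second. A section \<open>\<sigma>\<close> of \<open>E/N\<close> need not be the class of a section of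
  \<open>E\<close>, but every point has a neighbourhood \<open>V\<close> on which it is the class of some \<open>s \<in> E(V)\<close>, a lift of
  \<open>\<sigma>\<close> over \<open>V\<close>. Two lifts over \<open>V\<close> have the same germs modulo \<open>N\<close>, hence differ locally by sections of
  \<open>N\<close>, so for \<open>t \<in> M(V)\<close> the values \<open>ts\<close> agree locally and therefore on \<open>V\<close>, because \<open>A\<close> is
  separated (\<open>value_independent_of_lift\<close>). The values of \<open>t\<close> on all the lifts of \<open>\<sigma>\<close> are thus a
  compatible family, and \<open>A\<close> being a sheaf they glue to one section \<open>t\<sigma>\<close> (\<open>is_value_exists\<close>). It is
  the only section with the right local values, which gives bilinearity and compatibility with
  restrictions at once (\<open>sheaf_pairing_quotient\<close>).

  If \<open>\<sigma>\<close> and \<open>\<tau>\<close> induce the same map on \<open>M\<close>, choose common neighbourhoods with lifts \<open>s\<close> and \<open>s'\<close>. Then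
  \<open>s - s'\<close> is orthogonal to \<open>M(V)\<close>; when \<open>N\<close> is all of the orthogonal of \<open>M\<close>, it lies in \<open>N(V)\<close>, so
  \<open>\<sigma> = \<tau>\<close> on \<open>V\<close> (\<open>right_to_dual_injective\<close>). If \<open>t\<close> and \<open>t'\<close> in \<open>M(U)\<close> induce the same map on \<open>E/N\<close>,
  they agree on the classes of all the sections of \<open>E\<close> over \<open>U\<close>, so \<open>t - t'\<close> is in the left kernel,
  which vanishes (\<open>left_to_dual_injective\<close>).
\<close>

section \<open>Sheaves and germs\<close>

text \<open>
  Locality for the cover by all open sets on which the two sections agree, so that a later argument
  only has to produce one neighbourhood of each point.
\<close>

lemma (in sheaf) section_eq_locally:
  assumes U: "openin T U" and st: "s \<in> carrier (sections P U)" "t \<in> carrier (sections P U)"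
    and loc: "\<And>x. x \<in> U \<Longrightarrow> \<exists>V. openin T V \<and> x \<in> V \<and> V \<subseteq> U \<and> restr P U V s = restr P U V t"
  shows "s = t"
proof -
  define \<U> where "\<U> = {V. openin T V \<and> V \<subseteq> U \<and> restr P U V s = restr P U V t}"
  have un: "\<Union>\<U> = U"
    unfolding \<U>_def using loc by blast
  show ?thesis
    by (rule locality[of \<U>]) (use st un in \<open>auto simp: \<U>_def\<close>)
qed

context presheaf
begin

text \<open>
  A germ is encoded as the set of its representatives, so equal germs have the same representatives.
  This comes down to agreement near \<open>x\<close> because agreement near \<open>x\<close> is transitive.
\<close>

lemma germ_eq_iff:
  assumes "openin T U" "openin T V" "x \<in> V" "s \<in> carrier (sections P U)" "t \<in> carrier (sections P V)"
  shows "germ T P U s x = germ T P V t x \<longleftrightarrow>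
    (\<exists>W. openin T W \<and> x \<in> W \<and> W \<subseteq> U \<inter> V \<and> restr P U W s = restr P V W t)" (is "_ \<longleftrightarrow> ?R")
proof
  assume eq: "germ T P U s x = germ T P V t x"
  have "(V, t) \<in> germ T P V t x"
    unfolding germ_def using assms by blast
  then show ?R
    unfolding eq[symmetric] by (auto simp: germ_def)
next
  assume ?R
  then obtain W where W: "openin T W" "x \<in> W" "W \<subseteq> U" "W \<subseteq> V" "restr P U W s = restr P V W t"
    by auto
  have sub: "germ T P U1 s1 x \<subseteq> germ T P U2 s2 x"
    if U12: "openin T U1" "openin T U2" "W \<subseteq> U1" "W \<subseteq> U2"
      and s12: "s1 \<in> carrier (sections P U1)" "s2 \<in> carrier (sections P U2)"
      and eq: "restr P U1 W s1 = restr P U2 W s2"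
    for U1 U2 s1 s2
  proof (rule subrelI)
    fix V' t' assume mem: "(V', t') \<in> germ T P U1 s1 x"
    then obtain W1 where V': "openin T V'" "x \<in> V'" "t' \<in> carrier (sections P V')"
      and W1: "openin T W1" "x \<in> W1" "W1 \<subseteq> U1" "W1 \<subseteq> V'" "restr P U1 W1 s1 = restr P V' W1 t'"
      by (auto simp: germ_def)
    \<comment> \<open>\<open>s1\<close> agrees with \<open>s2\<close> on \<open>W\<close> and with \<open>t'\<close> on \<open>W1\<close>; compare \<open>s2\<close> and \<open>t'\<close> on the intersection.\<close>
    let ?I = "W \<inter> W1"
    have I: "openin T ?I"
      using W W1 by auto
    have "restr P U2 ?I s2 = restr P W ?I (restr P U2 W s2)"
      using restr_restr[of U2 W ?I s2] U12 s12 W I by auto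
    also have "\<dots> = restr P W1 ?I (restr P U1 W1 s1)"
      using restr_restr[of U1 W ?I s1] restr_restr[of U1 W1 ?I s1] U12 s12 W W1 I
      by (auto simp flip: eq)
    also have "\<dots> = restr P V' ?I t'"
      using restr_restr[of V' W1 ?I t'] V' W1 I by auto
    finally show "(V', t') \<in> germ T P U2 s2 x"
      unfolding germ_def using I V' W(2) W1(2,4) U12(4)
      by (intro CollectI case_prodI conjI exI[of _ ?I]) auto
  qed
  show "germ T P U s x = germ T P V t x"
    using sub[of U V s t] sub[of V U t s] assms W by auto
qed

lemma germ_restr:
  assumes "openin T U" "openin T V" "V \<subseteq> U" "x \<in> V" "s \<in> carrier (sections P U)"
  shows "germ T P V (restr P U V s) x = germ T P U s x"
  using assms by (subst germ_eq_iff) (auto intro!: exI[of _ V] simp: restr_closed restr_id)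

lemma mem_germ_iff:
  assumes "openin T U" "x \<in> U" "s \<in> carrier (sections P U)"
  shows "(V, t) \<in> germ T P U s x \<longleftrightarrow>
    openin T V \<and> x \<in> V \<and> t \<in> carrier (sections P V) \<and> germ T P V t x = germ T P U s x"
proof (cases "openin T V \<and> x \<in> V \<and> t \<in> carrier (sections P V)")
  case True
  then have "(V, t) \<in> germ T P U s x \<longleftrightarrow> germ T P U s x = germ T P V t x"
    using assms by (simp add: germ_eq_iff) (simp add: germ_def)
  with True show ?thesis
    by (metis (no_types))
qed (auto simp: germ_def)

end


section \<open>The sheaf generated by a presheaf of modules\<close>

lemma UN_pair_constant:
  assumes "(a, b) \<in> S" and "\<And>a b. (a, b) \<in> S \<Longrightarrow> f a b = c"
  shows "(\<Union>(a, b)\<in>S. f a b) = c"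
  using assms by fastforce

text \<open>
  Operations that commute with restriction: this is what makes the stalkwise operations independent
  of representatives. A presheaf of quotients, the quotient sheaf and a subsheaf are all instances.
\<close>

locale presheaf_of_modules = A: presheaf T A + presheaf T P
  for T :: "'x topology" and A :: "('x, complex, 'a) presheaf_data"
    and P :: "('x, 'a, 'm) presheaf_data" +
  assumes add_closed:
      "\<lbrakk>openin T U; s \<in> carrier (sections P U); t \<in> carrier (sections P U)\<rbrakk>
        \<Longrightarrow> s \<oplus>\<^bsub>sections P U\<^esub> t \<in> carrier (sections P U)"
    and smult_closed:
      "\<lbrakk>openin T U; a \<in> carrier (sections A U); s \<in> carrier (sections P U)\<rbrakk>
        \<Longrightarrow> a \<odot>\<^bsub>sections P U\<^esub> s \<in> carrier (sections P U)"
    and restr_add: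
      "\<lbrakk>openin T U; openin T V; V \<subseteq> U; s \<in> carrier (sections P U); t \<in> carrier (sections P U)\<rbrakk>
        \<Longrightarrow> restr P U V (s \<oplus>\<^bsub>sections P U\<^esub> t) = restr P U V s \<oplus>\<^bsub>sections P V\<^esub> restr P U V t"
    and restr_smult:
      "\<lbrakk>openin T U; openin T V; V \<subseteq> U; a \<in> carrier (sections A U); s \<in> carrier (sections P U)\<rbrakk>
        \<Longrightarrow> restr P U V (a \<odot>\<^bsub>sections P U\<^esub> s) = restr A U V a \<odot>\<^bsub>sections P V\<^esub> restr P U V s"
begin

lemma germ_add_cong:
  assumes opens: "openin T U" "openin T V" "openin T W" and x: "x \<in> U" "x \<in> V" "x \<in> W"
    and secs: "s \<in> carrier (sections P U)" "t \<in> carrier (sections P U)"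
      "s' \<in> carrier (sections P V)" "t' \<in> carrier (sections P W)"
    and germs: "germ T P V s' x = germ T P U s x" "germ T P W t' x = germ T P U t x"
  shows "germ T P (V \<inter> W)
      (restr P V (V \<inter> W) s' \<oplus>\<^bsub>sections P (V \<inter> W)\<^esub> restr P W (V \<inter> W) t') x =
    germ T P U (s \<oplus>\<^bsub>sections P U\<^esub> t) x"
proof -
  obtain S where S: "openin T S" "x \<in> S" "S \<subseteq> V" "S \<subseteq> U" "restr P V S s' = restr P U S s"
    using germs(1) opens x secs by (subst (asm) germ_eq_iff) auto
  obtain R where R: "openin T R" "x \<in> R" "R \<subseteq> W" "R \<subseteq> U" "restr P W R t' = restr P U R t"
    using germs(2) opens x secs by (subst (asm) germ_eq_iff) auto
  have VW: "openin T (V \<inter> W)" and SR: "openin T (S \<inter> R)"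
    using opens S R by auto
  have SRVW: "S \<inter> R \<subseteq> V \<inter> W"
    using S R by blast
  have s': "restr P V (S \<inter> R) s' = restr P U (S \<inter> R) s"
    using restr_restr[of V S "S \<inter> R" s'] restr_restr[of U S "S \<inter> R" s] S SR opens secs by auto
  have t': "restr P W (S \<inter> R) t' = restr P U (S \<inter> R) t"
    using restr_restr[of W R "S \<inter> R" t'] restr_restr[of U R "S \<inter> R" t] R SR opens secs by auto
  have cl: "restr P V (V \<inter> W) s' \<in> carrier (sections P (V \<inter> W))"
    "restr P W (V \<inter> W) t' \<in> carrier (sections P (V \<inter> W))"
    using opens secs VW by (auto intro!: restr_closed)
  have "restr P (V \<inter> W) (S \<inter> R)
      (restr P V (V \<inter> W) s' \<oplus>\<^bsub>sections P (V \<inter> W)\<^esub> restr P W (V \<inter> W) t')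
    = restr P (V \<inter> W) (S \<inter> R) (restr P V (V \<inter> W) s') \<oplus>\<^bsub>sections P (S \<inter> R)\<^esub>
      restr P (V \<inter> W) (S \<inter> R) (restr P W (V \<inter> W) t')"
    using VW SR S R cl by (intro restr_add) auto
  also have "\<dots> = restr P U (S \<inter> R) s \<oplus>\<^bsub>sections P (S \<inter> R)\<^esub> restr P U (S \<inter> R) t"
    using restr_restr[of V "V \<inter> W" "S \<inter> R" s'] restr_restr[of W "V \<inter> W" "S \<inter> R" t']
      VW SR opens secs SRVW by (simp add: s' t')
  also have "\<dots> = restr P U (S \<inter> R) (s \<oplus>\<^bsub>sections P U\<^esub> t)"
    using SR S R opens secs by (intro restr_add[symmetric]) auto
  finally have "restr P (V \<inter> W) (S \<inter> R)
      (restr P V (V \<inter> W) s' \<oplus>\<^bsub>sections P (V \<inter> W)\<^esub> restr P W (V \<inter> W) t')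
    = restr P U (S \<inter> R) (s \<oplus>\<^bsub>sections P U\<^esub> t)" .
  then show ?thesis
    using VW SR S R opens secs cl x
    by (subst germ_eq_iff) (auto intro!: add_closed exI[of _ "S \<inter> R"])
qed

lemma germ_smult_cong:
  assumes opens: "openin T U" "openin T V" "openin T W" and x: "x \<in> V" "x \<in> W" and VU: "V \<subseteq> U"
    and secs: "a \<in> carrier (sections A U)" "s \<in> carrier (sections P V)" "s' \<in> carrier (sections P W)"
    and germs: "germ T P W s' x = germ T P V s x"
  shows "germ T P (U \<inter> W)
      (restr A U (U \<inter> W) a \<odot>\<^bsub>sections P (U \<inter> W)\<^esub> restr P W (U \<inter> W) s') x =
    germ T P V (restr A U V a \<odot>\<^bsub>sections P V\<^esub> s) x"
proof -
  obtain S where S: "openin T S" "x \<in> S" "S \<subseteq> W" "S \<subseteq> V" "restr P W S s' = restr P V S s"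
    using germs opens x secs by (subst (asm) germ_eq_iff) auto
  have UW: "openin T (U \<inter> W)"
    using opens by auto
  have cl: "restr A U (U \<inter> W) a \<in> carrier (sections A (U \<inter> W))"
    "restr A U V a \<in> carrier (sections A V)"
    "restr P W (U \<inter> W) s' \<in> carrier (sections P (U \<inter> W))"
    using opens secs UW VU by (auto intro!: restr_closed A.restr_closed)
  have "restr P (U \<inter> W) S (restr A U (U \<inter> W) a \<odot>\<^bsub>sections P (U \<inter> W)\<^esub> restr P W (U \<inter> W) s')
      = restr A (U \<inter> W) S (restr A U (U \<inter> W) a) \<odot>\<^bsub>sections P S\<^esub>
        restr P (U \<inter> W) S (restr P W (U \<inter> W) s')"
    using UW S cl VU by (intro restr_smult) auto
  also have "\<dots> = restr A V S (restr A U V a) \<odot>\<^bsub>sections P S\<^esub> restr P V S s"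
    using A.restr_restr[of U "U \<inter> W" S a] A.restr_restr[of U V S a] restr_restr[of W "U \<inter> W" S s']
      UW S opens secs VU by auto
  also have "\<dots> = restr P V S (restr A U V a \<odot>\<^bsub>sections P V\<^esub> s)"
    using S opens secs cl by (intro restr_smult[symmetric]) auto
  finally show ?thesis
    using UW S opens secs cl x VU
    by (subst germ_eq_iff) (auto intro!: smult_closed exI[of _ S])
qed

text \<open>
  The sum in the generated sheaf is a union over all pairs of representatives. Each pair contributes
  the same germ, and there is at least one pair, so any chosen representatives compute the sum; likewise
  for scalar multiples.
\<close>

lemma generated_add_germ:
  assumes "openin T V" "x \<in> V" "x \<in> U" "s \<in> carrier (sections P V)" "t \<in> carrier (sections P V)"
    and "\<sigma> x = germ T P V s x" "\<tau> x = germ T P V t x"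
  shows "(\<sigma> \<oplus>\<^bsub>sections (generated_sheaf T A P) U\<^esub> \<tau>) x = germ T P V (s \<oplus>\<^bsub>sections P V\<^esub> t) x"
proof -
  have mem: "(V, s) \<in> germ T P V s x" "(V, t) \<in> germ T P V t x"
    using assms by (auto simp: mem_germ_iff)
  have "(\<sigma> \<oplus>\<^bsub>sections (generated_sheaf T A P) U\<^esub> \<tau>) x =
     (\<Union>(W, s')\<in>germ T P V s x. \<Union>(W', t')\<in>germ T P V t x.
        germ T P (W \<inter> W') (restr P W (W \<inter> W') s' \<oplus>\<^bsub>sections P (W \<inter> W')\<^esub> restr P W' (W \<inter> W') t') x)"
    using assms unfolding generated_sheaf_def by simp
  also have "\<dots> = germ T P V (s \<oplus>\<^bsub>sections P V\<^esub> t) x"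
    by (intro UN_pair_constant[OF mem(1)] UN_pair_constant[OF mem(2)] germ_add_cong)
      (use assms in \<open>auto simp: mem_germ_iff\<close>)
  finally show ?thesis .
qed

lemma generated_smult_germ:
  assumes "openin T U" "openin T V" "V \<subseteq> U" "x \<in> V"
    and "a \<in> carrier (sections A U)" "s \<in> carrier (sections P V)" and "\<sigma> x = germ T P V s x"
  shows "(a \<odot>\<^bsub>sections (generated_sheaf T A P) U\<^esub> \<sigma>) x =
    germ T P V (restr A U V a \<odot>\<^bsub>sections P V\<^esub> s) x"
proof -
  have mem: "(V, s) \<in> germ T P V s x"
    using assms by (auto simp: mem_germ_iff)
  have "(a \<odot>\<^bsub>sections (generated_sheaf T A P) U\<^esub> \<sigma>) x = (\<Union>(W, s')\<in>germ T P V s x.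
      germ T P (U \<inter> W) (restr A U (U \<inter> W) a \<odot>\<^bsub>sections P (U \<inter> W)\<^esub> restr P W (U \<inter> W) s') x)"
    using assms unfolding generated_sheaf_def by auto
  also have "\<dots> = germ T P V (restr A U V a \<odot>\<^bsub>sections P V\<^esub> s) x"
    by (intro UN_pair_constant[OF mem] germ_smult_cong) (use assms in \<open>auto simp: mem_germ_iff\<close>)
  finally show ?thesis .
qed

end

section \<open>Quotients and local lifts\<close>

context submodule_sheaf
begin

lemma abelian_subgroup_sections: "openin T U \<Longrightarrow> abelian_subgroup (N U) (sections E U)"
  using submodule_sections module_sections
  by (intro abelian_subgroupI3 additive_subgroup.intro)
     (auto simp: submodule_def module_def)

lemma sub_restr_closed:
  "\<lbrakk>openin T U; openin T V; V \<subseteq> U; n \<in> N U\<rbrakk> \<Longrightarrow> restr E U V n \<in> N V"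
  using sub.restr_closed[of U V n] by (simp add: subpresheaf_def)

lemma sub_carrier: "\<lbrakk>openin T U; n \<in> N U\<rbrakk> \<Longrightarrow> n \<in> carrier (sections E U)"
  using module.submoduleE(1)[OF module_sections submodule_sections] by blast

lemma coset_absorb:
  assumes "openin T U" "n \<in> N U" "s \<in> carrier (sections E U)"
  shows "N U +>\<^bsub>sections E U\<^esub> (n \<oplus>\<^bsub>sections E U\<^esub> s) = N U +>\<^bsub>sections E U\<^esub> s"
proof -
  interpret abelian_subgroup "N U" "sections E U"
    by (rule abelian_subgroup_sections[OF assms(1)])
  show ?thesis
    using assms by (intro a_repr_independence'[symmetric]) (auto simp: a_r_coset_def')
qed

lemma coset_eq_iff:
  assumes "openin T U" "s \<in> carrier (sections E U)" "t \<in> carrier (sections E U)"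
  shows "N U +>\<^bsub>sections E U\<^esub> s = N U +>\<^bsub>sections E U\<^esub> t \<longleftrightarrow> s \<ominus>\<^bsub>sections E U\<^esub> t \<in> N U"
proof -
  interpret abelian_subgroup "N U" "sections E U"
    by (rule abelian_subgroup_sections[OF assms(1)])
  show ?thesis
    using assms a_rcos_module[of t s] a_rcos_self[of s] a_repr_independence'[of s t]
    by (auto simp: a_minus_def)
qed

text \<open>
  Restriction and scalar multiplication on cosets are unions over all members of the coset; the
  members differ by sections of \<open>N\<close>, which restriction and scalar multiplication keep in \<open>N\<close>.
\<close>

lemma restr_coset:
  assumes "openin T U" "openin T V" "V \<subseteq> U" "s \<in> carrier (sections E U)"
  shows "restr (quotient_presheaf E N) U V (N U +>\<^bsub>sections E U\<^esub> s) =
    N V +>\<^bsub>sections E V\<^esub> restr E U V s"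
proof -
  interpret abelian_subgroup "N U" "sections E U"
    by (rule abelian_subgroup_sections[OF assms(1)])
  have "N V +>\<^bsub>sections E V\<^esub> restr E U V s' = N V +>\<^bsub>sections E V\<^esub> restr E U V s"
    if s': "s' \<in> N U +>\<^bsub>sections E U\<^esub> s" for s'
  proof -
    obtain n where n: "n \<in> N U" "s' = n \<oplus>\<^bsub>sections E U\<^esub> s"
      using s' by (auto simp: a_r_coset_def')
    then show ?thesis
      using assms by (simp add: restr_add sub_carrier coset_absorb sub_restr_closed restr_closed)
  qed
  then show ?thesis
    unfolding quotient_presheaf_def presheaf_data.simps
    by (intro UN_constant_eq[OF a_rcos_self[OF assms(4)]] ballI)
qed

lemma smult_coset:
  assumes "openin T U" "a \<in> carrier (sections A U)" "s \<in> carrier (sections E U)"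
  shows "a \<odot>\<^bsub>sections (quotient_presheaf E N) U\<^esub> (N U +>\<^bsub>sections E U\<^esub> s) =
    N U +>\<^bsub>sections E U\<^esub> (a \<odot>\<^bsub>sections E U\<^esub> s)"
proof -
  interpret abelian_subgroup "N U" "sections E U"
    by (rule abelian_subgroup_sections[OF assms(1)])
  interpret M: module "sections A U" "sections E U"
    by (rule module_sections[OF assms(1)])
  have "N U +>\<^bsub>sections E U\<^esub> (a \<odot>\<^bsub>sections E U\<^esub> s') = N U +>\<^bsub>sections E U\<^esub> (a \<odot>\<^bsub>sections E U\<^esub> s)"
    if s': "s' \<in> N U +>\<^bsub>sections E U\<^esub> s" for s'
  proof -
    obtain n where n: "n \<in> N U" "s' = n \<oplus>\<^bsub>sections E U\<^esub> s"
      using s' by (auto simp: a_r_coset_def')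
    have "a \<odot>\<^bsub>sections E U\<^esub> n \<in> N U"
      using M.submoduleE(4)[OF submodule_sections] n assms by blast
    then show ?thesis
      using n assms by (simp add: M.smult_r_distr sub_carrier coset_absorb)
  qed
  then show ?thesis
    unfolding quotient_presheaf_def quotient_module_def
    unfolding presheaf_data.simps module.simps
    by (intro UN_constant_eq[OF a_rcos_self[OF assms(3)]] ballI)
qed

lemma add_coset:
  assumes "openin T U" "s \<in> carrier (sections E U)" "t \<in> carrier (sections E U)"
  shows "(N U +>\<^bsub>sections E U\<^esub> s) \<oplus>\<^bsub>sections (quotient_presheaf E N) U\<^esub> (N U +>\<^bsub>sections E U\<^esub> t) =
    N U +>\<^bsub>sections E U\<^esub> (s \<oplus>\<^bsub>sections E U\<^esub> t)"
  using abelian_subgroup.a_rcos_sum[OF abelian_subgroup_sections[OF assms(1)] assms(2,3)]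
  by (simp add: quotient_presheaf_def quotient_module_def)

lemma carrier_quotient_presheaf:
  "carrier (sections (quotient_presheaf E N) U) =
    (\<lambda>s. N U +>\<^bsub>sections E U\<^esub> s) ` carrier (sections E U)"
  by (auto simp: quotient_presheaf_def quotient_module_def A_RCOSETS_def')

lemma add_section_closed:
  "\<lbrakk>openin T U; s \<in> carrier (sections E U); t \<in> carrier (sections E U)\<rbrakk>
    \<Longrightarrow> s \<oplus>\<^bsub>sections E U\<^esub> t \<in> carrier (sections E U)"
  using module.axioms(2)[OF module_sections] by (meson abelian_groupE(1))

lemma smult_section_closed:
  "\<lbrakk>openin T U; a \<in> carrier (sections A U); s \<in> carrier (sections E U)\<rbrakk>
    \<Longrightarrow> a \<odot>\<^bsub>sections E U\<^esub> s \<in> carrier (sections E U)"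
  by (rule module.smult_closed[OF module_sections])

sublocale quot: presheaf_of_modules T A "quotient_presheaf E N"
proof
  fix U V W C D a
  assume U: "openin T U" and C: "C \<in> carrier (sections (quotient_presheaf E N) U)"
  obtain s where s: "s \<in> carrier (sections E U)" "C = N U +>\<^bsub>sections E U\<^esub> s"
    using C by (auto simp: carrier_quotient_presheaf)
  show "restr (quotient_presheaf E N) U U C = C"
    using U s by (simp add: restr_coset restr_id)
  show "a \<odot>\<^bsub>sections (quotient_presheaf E N) U\<^esub> C \<in> carrier (sections (quotient_presheaf E N) U)"
    if "a \<in> carrier (sections A U)"
    using U s that smult_section_closed by (simp add: smult_coset carrier_quotient_presheaf)
  show "C \<oplus>\<^bsub>sections (quotient_presheaf E N) U\<^esub> D \<in> carrier (sections (quotient_presheaf E N) U)"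
    if "D \<in> carrier (sections (quotient_presheaf E N) U)"
    using U s that add_section_closed by (auto simp: add_coset carrier_quotient_presheaf)
  assume V: "openin T V"
  show "restr (quotient_presheaf E N) U V C \<in> carrier (sections (quotient_presheaf E N) V)"
    if "V \<subseteq> U"
    using U V s that restr_closed by (simp add: restr_coset carrier_quotient_presheaf)
  show "restr (quotient_presheaf E N) V W (restr (quotient_presheaf E N) U V C) =
      restr (quotient_presheaf E N) U W C" if "openin T W" "W \<subseteq> V" "V \<subseteq> U"
    using U V s that restr_coset[of U W s] by (simp add: restr_coset restr_closed restr_restr)
  show "restr (quotient_presheaf E N) U V (C \<oplus>\<^bsub>sections (quotient_presheaf E N) U\<^esub> D) =
      restr (quotient_presheaf E N) U V C \<oplus>\<^bsub>sections (quotient_presheaf E N) V\<^esub>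
      restr (quotient_presheaf E N) U V D"
    if VU: "V \<subseteq> U" and D: "D \<in> carrier (sections (quotient_presheaf E N) U)"
  proof -
    obtain t where "t \<in> carrier (sections E U)" "D = N U +>\<^bsub>sections E U\<^esub> t"
      using D by (auto simp: carrier_quotient_presheaf)
    then show ?thesis
      using U V VU s by (simp add: add_coset restr_coset restr_closed restr_add add_section_closed)
  qed
  show "restr (quotient_presheaf E N) U V (a \<odot>\<^bsub>sections (quotient_presheaf E N) U\<^esub> C) =
      restr A U V a \<odot>\<^bsub>sections (quotient_presheaf E N) V\<^esub> restr (quotient_presheaf E N) U V C"
    if "V \<subseteq> U" "a \<in> carrier (sections A U)"
    using U V s that
    by (simp add: smult_coset restr_coset restr_closed restr_smult smult_section_closed
        A.restr_closed)
qed

end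

lemma quotient_sheaf_simps:
  "restr (quotient_sheaf T A E N) U V \<sigma> = restrict \<sigma> V"
  "carrier (sections (quotient_sheaf T A E N) U) = {\<sigma> \<in> extensional U.
     \<forall>x\<in>U. \<exists>V s. openin T V \<and> x \<in> V \<and> V \<subseteq> U \<and> s \<in> carrier (sections (quotient_presheaf E N) V) \<and>
       (\<forall>y\<in>V. \<sigma> y = germ T (quotient_presheaf E N) V s y)}"
  by (simp_all add: quotient_sheaf_def generated_sheaf_def)

text \<open>
  Only the values of \<open>\<sigma>\<close> on \<open>V\<close> count: a section of the quotient over a large open set has to be
  compared with lifts over varying smaller ones, without restricting it each time.
\<close>

definition lifts_to ::
    "'x topology \<Rightarrow> ('x, 'a, 'e) presheaf_data \<Rightarrow> ('x set \<Rightarrow> 'e set) \<Rightarrow> 'x set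
      \<Rightarrow> ('x \<Rightarrow> ('x set \<times> 'e set) set) \<Rightarrow> 'e \<Rightarrow> bool" where
  "lifts_to T E N V \<sigma> s \<longleftrightarrow> openin T V \<and> s \<in> carrier (sections E V) \<and>
     (\<forall>x\<in>V. \<sigma> x = quotient_section T E N V s x)"

lemma lifts_toD:
  assumes "lifts_to T E N V \<sigma> s"
  shows "openin T V" "s \<in> carrier (sections E V)"
  using assms by (simp_all add: lifts_to_def)

context submodule_sheaf
begin

abbreviation "Q \<equiv> quotient_sheaf T A E N"

lemma lifts_to_quotient_section:
  "\<lbrakk>openin T U; s \<in> carrier (sections E U)\<rbrakk> \<Longrightarrow> lifts_to T E N U (quotient_section T E N U s) s"
  by (simp add: lifts_to_def)

lemma carrier_quotient_sheaf:
  "carrier (sections Q U) =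
    {\<sigma> \<in> extensional U. \<forall>x\<in>U. \<exists>V s. x \<in> V \<and> V \<subseteq> U \<and> lifts_to T E N V \<sigma> s}"
  unfolding quotient_sheaf_simps carrier_quotient_presheaf lifts_to_def quotient_section_def
  by (simp add: bex_simps) blast

lemma lift_exists:
  "\<lbrakk>\<sigma> \<in> carrier (sections Q U); x \<in> U\<rbrakk> \<Longrightarrow> \<exists>V s. x \<in> V \<and> V \<subseteq> U \<and> lifts_to T E N V \<sigma> s"
  by (auto simp: carrier_quotient_sheaf)

lemma coset_in_quotient:
  "s \<in> carrier (sections E U)
    \<Longrightarrow> N U +>\<^bsub>sections E U\<^esub> s \<in> carrier (sections (quotient_presheaf E N) U)"
  by (simp add: carrier_quotient_presheaf)

lemma lifts_to_restr:
  assumes "lifts_to T E N V \<sigma> s" "openin T W" "W \<subseteq> V"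
  shows "lifts_to T E N W \<sigma> (restr E V W s)"
proof -
  have "germ T (quotient_presheaf E N) V (N V +>\<^bsub>sections E V\<^esub> s) x =
      germ T (quotient_presheaf E N) W (N W +>\<^bsub>sections E W\<^esub> restr E V W s) x" if "x \<in> W" for x
    using assms that quot.germ_restr[of V W x "N V +>\<^bsub>sections E V\<^esub> s"]
    by (simp add: lifts_to_def coset_in_quotient restr_coset)
  then show ?thesis
    using assms by (auto simp: lifts_to_def quotient_section_def restr_closed subset_iff)
qed

lemma lifts_to_cong:
  assumes "\<And>x. x \<in> V \<Longrightarrow> \<sigma> x = \<tau> x"
  shows "lifts_to T E N V \<sigma> s \<longleftrightarrow> lifts_to T E N V \<tau> s"
  using assms by (auto simp: lifts_to_def)

lemma lifts_to_restrict:
  "W \<subseteq> V \<Longrightarrow> lifts_to T E N W (restrict \<sigma> V) s \<longleftrightarrow> lifts_to T E N W \<sigma> s"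
  by (intro lifts_to_cong) auto

text \<open>
  Equality of germs in the quotient presheaf is equality of cosets over some smaller neighbourhood,
  whence the restriction of the lifts to \<open>W\<close>.
\<close>

lemma lifts_differ_locally:
  assumes "lifts_to T E N V \<sigma> s" "lifts_to T E N V \<sigma> t" "x \<in> V"
  shows "\<exists>W. openin T W \<and> x \<in> W \<and> W \<subseteq> V \<and>
    restr E V W s \<ominus>\<^bsub>sections E W\<^esub> restr E V W t \<in> N W"
proof -
  have V: "openin T V" and st: "s \<in> carrier (sections E V)" "t \<in> carrier (sections E V)"
    using assms by (auto simp: lifts_to_def)
  have "germ T (quotient_presheaf E N) V (N V +>\<^bsub>sections E V\<^esub> s) x =
      germ T (quotient_presheaf E N) V (N V +>\<^bsub>sections E V\<^esub> t) x"
    using assms by (simp add: lifts_to_def quotient_section_def)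
  then obtain W where W: "openin T W" "x \<in> W" "W \<subseteq> V"
    "restr (quotient_presheaf E N) V W (N V +>\<^bsub>sections E V\<^esub> s) =
     restr (quotient_presheaf E N) V W (N V +>\<^bsub>sections E V\<^esub> t)"
    using V st assms(3) by (subst (asm) quot.germ_eq_iff) (auto simp: coset_in_quotient)
  then have "restr E V W s \<ominus>\<^bsub>sections E W\<^esub> restr E V W t \<in> N W"
    using V st by (simp add: restr_coset flip: coset_eq_iff add: restr_closed)
  with W show ?thesis by blast
qed

lemma lifts_to_diff:
  assumes "lifts_to T E N V \<sigma> s" "lifts_to T E N V \<tau> t"
    and "s \<ominus>\<^bsub>sections E V\<^esub> t \<in> N V"
  shows "\<forall>x\<in>V. \<sigma> x = \<tau> x"
proof -
  have "N V +>\<^bsub>sections E V\<^esub> s = N V +>\<^bsub>sections E V\<^esub> t"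
    using assms by (subst coset_eq_iff) (auto simp: lifts_to_def)
  then show ?thesis
    using assms by (simp add: lifts_to_def quotient_section_def)
qed

lemma lifts_to_add:
  assumes "lifts_to T E N V \<sigma> s" "lifts_to T E N V \<tau> t" "V \<subseteq> U"
  shows "lifts_to T E N V (\<sigma> \<oplus>\<^bsub>sections Q U\<^esub> \<tau>) (s \<oplus>\<^bsub>sections E V\<^esub> t)"
  using assms quot.generated_add_germ[of V _ U "N V +>\<^bsub>sections E V\<^esub> s" "N V +>\<^bsub>sections E V\<^esub> t" \<sigma> \<tau>]
  by (auto simp: lifts_to_def quotient_section_def quotient_sheaf_def add_section_closed
      coset_in_quotient add_coset)

lemma lifts_to_smult:
  assumes "openin T U" "lifts_to T E N V \<sigma> s" "V \<subseteq> U" "a \<in> carrier (sections A U)"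
  shows "lifts_to T E N V (a \<odot>\<^bsub>sections Q U\<^esub> \<sigma>) (restr A U V a \<odot>\<^bsub>sections E V\<^esub> s)"
  using assms quot.generated_smult_germ[of U V _ a "N V +>\<^bsub>sections E V\<^esub> s" \<sigma>]
  by (auto simp: lifts_to_def quotient_section_def quotient_sheaf_def smult_section_closed
      coset_in_quotient smult_coset A.restr_closed)

lemma quotient_section_closed:
  assumes "openin T U" "s \<in> carrier (sections E U)"
  shows "quotient_section T E N U s \<in> carrier (sections Q U)"
  using assms lifts_to_quotient_section[OF assms]
  by (auto simp: carrier_quotient_sheaf) (simp add: quotient_section_def)

lemma quotient_restr_add:
  "V \<subseteq> U \<Longrightarrow> restr Q U V (\<sigma> \<oplus>\<^bsub>sections Q U\<^esub> \<tau>) =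
    restr Q U V \<sigma> \<oplus>\<^bsub>sections Q V\<^esub> restr Q U V \<tau>"
  by (auto simp: quotient_sheaf_def generated_sheaf_def fun_eq_iff restrict_def subset_iff)

text \<open>
  The scalar multiple over \<open>U\<close> is computed with restrictions of \<open>a\<close> from \<open>U\<close>, and the one over \<open>V\<close>
  with restrictions from \<open>V\<close>; a common local lift shows that the two agree.
\<close>

lemma quotient_restr_smult:
  assumes U: "openin T U" and V: "openin T V" "V \<subseteq> U"
    and a: "a \<in> carrier (sections A U)" and \<sigma>: "\<sigma> \<in> carrier (sections Q U)"
  shows "restr Q U V (a \<odot>\<^bsub>sections Q U\<^esub> \<sigma>) = restr A U V a \<odot>\<^bsub>sections Q V\<^esub> restr Q U V \<sigma>"
proof (rule extensionalityI[of _ V])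
  show "restr Q U V (a \<odot>\<^bsub>sections Q U\<^esub> \<sigma>) \<in> extensional V"
    by (simp add: quotient_sheaf_simps(1))
  show "restr A U V a \<odot>\<^bsub>sections Q V\<^esub> restr Q U V \<sigma> \<in> extensional V"
    by (simp add: quotient_sheaf_def generated_sheaf_def)
  fix x assume x: "x \<in> V"
  then obtain S s where S: "x \<in> S" "lifts_to T E N S \<sigma> s"
    using lift_exists[OF \<sigma>, of x] V by auto
  define W where "W = S \<inter> V"
  have W: "x \<in> W" "W \<subseteq> V" and lift: "lifts_to T E N W \<sigma> (restr E S W s)"
    using S V x lifts_to_restr[OF S(2), of W] by (auto simp: W_def lifts_to_def)
  let ?s = "restr E S W s"
  have "lifts_to T E N W (a \<odot>\<^bsub>sections Q U\<^esub> \<sigma>) (restr A U W a \<odot>\<^bsub>sections E W\<^esub> ?s)"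
    using lifts_to_smult[OF U lift _ a] W V by auto
  moreover have "lifts_to T E N W (restr A U V a \<odot>\<^bsub>sections Q V\<^esub> restr Q U V \<sigma>)
      (restr A U W a \<odot>\<^bsub>sections E W\<^esub> ?s)"
    using lifts_to_smult[OF V(1), of W "restr Q U V \<sigma>" ?s "restr A U V a"] lift W V U a
    by (simp add: quotient_sheaf_simps(1) lifts_to_restrict A.restr_closed A.restr_restr
        lifts_to_def[of T E N W \<sigma>])
  ultimately show "restr Q U V (a \<odot>\<^bsub>sections Q U\<^esub> \<sigma>) x = (restr A U V a \<odot>\<^bsub>sections Q V\<^esub> restr Q U V \<sigma>) x"
    using x W by (simp add: quotient_sheaf_simps(1) lifts_to_def)
qed

lemma common_lift:
  assumes "\<sigma> \<in> carrier (sections Q U)" "\<tau> \<in> carrier (sections Q U)" "x \<in> U"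
  shows "\<exists>V s t. x \<in> V \<and> V \<subseteq> U \<and> lifts_to T E N V \<sigma> s \<and> lifts_to T E N V \<tau> t"
proof -
  obtain V s W t where V: "x \<in> V" "V \<subseteq> U" "lifts_to T E N V \<sigma> s"
    and W: "x \<in> W" "W \<subseteq> U" "lifts_to T E N W \<tau> t"
    using lift_exists[OF assms(1,3)] lift_exists[OF assms(2,3)] by blast
  have "openin T (V \<inter> W)"
    using V W by (auto simp: lifts_to_def)
  then have "lifts_to T E N (V \<inter> W) \<sigma> (restr E V (V \<inter> W) s)"
    "lifts_to T E N (V \<inter> W) \<tau> (restr E W (V \<inter> W) t)"
    using V W lifts_to_restr by auto
  with V W show ?thesis by blast
qed

sublocale quotient: presheaf_of_modules T A Q
proof
  fix U V W \<sigma>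
  assume \<sigma>: "\<sigma> \<in> carrier (sections Q U)" and U: "openin T U"
  show "restr Q U U \<sigma> = \<sigma>"
    using \<sigma> by (auto simp: carrier_quotient_sheaf quotient_sheaf_simps(1) extensional_restrict)
  show "restr Q V W (restr Q U V \<sigma>) = restr Q U W \<sigma>" if "W \<subseteq> V"
    using that by (simp add: quotient_sheaf_simps(1) Int_absorb1)
  show "restr Q U V \<sigma> \<in> carrier (sections Q V)" if V: "openin T V" "V \<subseteq> U"
    unfolding carrier_quotient_sheaf quotient_sheaf_simps(1)
  proof (intro CollectI conjI ballI)
    fix x assume "x \<in> V"
    then obtain S s where S: "x \<in> S" "lifts_to T E N S \<sigma> s"
      using lift_exists[OF \<sigma>, of x] V by auto
    have "lifts_to T E N (S \<inter> V) \<sigma> (restr E S (S \<inter> V) s)"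
      using S V by (intro lifts_to_restr) (auto simp: lifts_to_def)
    then show "\<exists>S s. x \<in> S \<and> S \<subseteq> V \<and> lifts_to T E N S (restrict \<sigma> V) s"
      using S \<open>x \<in> V\<close> by (intro exI[of _ "S \<inter> V"]) (auto simp: lifts_to_restrict)
  qed simp
  show "\<sigma> \<oplus>\<^bsub>sections Q U\<^esub> \<tau> \<in> carrier (sections Q U)" if \<tau>: "\<tau> \<in> carrier (sections Q U)" for \<tau>
  proof -
    have "\<sigma> \<oplus>\<^bsub>sections Q U\<^esub> \<tau> \<in> extensional U"
      by (simp add: quotient_sheaf_def generated_sheaf_def)
    moreover have "\<exists>V r. x \<in> V \<and> V \<subseteq> U \<and> lifts_to T E N V (\<sigma> \<oplus>\<^bsub>sections Q U\<^esub> \<tau>) r"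
      if "x \<in> U" for x
      using common_lift[OF \<sigma> \<tau> that] lifts_to_add by metis
    ultimately show ?thesis
      by (simp add: carrier_quotient_sheaf)
  qed
  show "a \<odot>\<^bsub>sections Q U\<^esub> \<sigma> \<in> carrier (sections Q U)" if a: "a \<in> carrier (sections A U)" for a
  proof -
    have "a \<odot>\<^bsub>sections Q U\<^esub> \<sigma> \<in> extensional U"
      by (simp add: quotient_sheaf_def generated_sheaf_def)
    moreover have "\<exists>V r. x \<in> V \<and> V \<subseteq> U \<and> lifts_to T E N V (a \<odot>\<^bsub>sections Q U\<^esub> \<sigma>) r"
      if "x \<in> U" for x
      using lift_exists[OF \<sigma> that] lifts_to_smult[OF U _ _ a] by metis
    ultimately show ?thesis
      by (simp add: carrier_quotient_sheaf)
  qed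
qed (simp_all add: quotient_restr_add quotient_restr_smult)

lemma presheaf_of_modules_sub: "presheaf_of_modules T A (subpresheaf E N)"
proof
  fix U s t a assume U: "openin T U" and s: "s \<in> carrier (sections (subpresheaf E N) U)"
  have M: "module (sections A U) (sections E U)" "submodule (N U) (sections A U) (sections E U)"
    using U by (simp_all add: module_sections submodule_sections)
  show "s \<oplus>\<^bsub>sections (subpresheaf E N) U\<^esub> t \<in> carrier (sections (subpresheaf E N) U)"
    if "t \<in> carrier (sections (subpresheaf E N) U)"
    using module.submoduleE(5)[OF M] that s by (simp add: subpresheaf_def)
  show "a \<odot>\<^bsub>sections (subpresheaf E N) U\<^esub> s \<in> carrier (sections (subpresheaf E N) U)"
    if "a \<in> carrier (sections A U)"
    using module.submoduleE(4)[OF M] that s by (simp add: subpresheaf_def)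
qed (auto simp: subpresheaf_def sub_carrier restr_add restr_smult)

end

section \<open>Pairings, their orthogonals and their descent to quotients\<close>

lemma sheaf_pairing_swap:
  assumes "sheaf_pairing T A F E \<theta>"
  shows "sheaf_pairing T A E F (\<lambda>U s t. \<theta> U t s)"
  using assms unfolding sheaf_pairing_def by auto

text \<open>
  Exchanging the two sides turns every statement about the right module into one about the left.
\<close>

lemma left_to_dual_swap:
  "left_to_dual T F E \<theta> = right_to_dual T E F (\<lambda>U s t. \<theta> U t s)"
  unfolding left_to_dual_def right_to_dual_def ..

text \<open>
  Linearity of the pairing in \<open>t\<close>, and its compatibility with restriction, put \<open>t \<mapsto> ts\<close> into the
  dual; linearity in \<open>s\<close> makes \<open>s \<mapsto> (t \<mapsto> ts)\<close> a morphism. The quotient sheaf appears as \<open>E\<close> in the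
  first half of the theorem and as \<open>F\<close> in the second.
\<close>

lemma right_to_dual_morphism:
  assumes "sheaf_pairing T A F E \<theta>" "presheaf_of_modules T A F" "presheaf_of_modules T A E"
  shows "sheaf_morphism T A E (dual_sheaf T A F) (right_to_dual T F E \<theta>)"
proof -
  interpret sheaf_pairing T A F E \<theta> by fact
  interpret F: presheaf_of_modules T A F by fact
  interpret E: presheaf_of_modules T A E by fact
  have opens: "openin (subtopology T U) V \<longleftrightarrow> openin T V \<and> V \<subseteq> U"
    "Collect (openin (subtopology T U)) = {V. openin T V \<and> V \<subseteq> U}" if "openin T U" for U V
    using openin_open_subtopology that by blast+
  let ?\<phi> = "right_to_dual T F E \<theta>"
  show ?thesis
    unfolding sheaf_morphism_def
  proof (intro allI impI conjI ballI funcsetI)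
    fix U s assume U: "openin T U" and s: "s \<in> carrier (sections E U)"
    show "?\<phi> U s \<in> carrier (sections (dual_sheaf T A F) U)"
      using s unfolding dual_sheaf_def hom_sheaf_def regular_sheaf_def sheaf_morphism_def
      by (auto simp: opens[OF U] right_to_dual_def pairing_closed E.restr_closed F.restr_closed
          pairing_add_left pairing_smult_left pairing_restr E.restr_restr F.add_closed
          F.smult_closed U subset_trans split: if_splits simp del: openin_subtopology)
  next
    fix U s t assume "openin T U" "s \<in> carrier (sections E U)" "t \<in> carrier (sections E U)"
    then show "?\<phi> U (s \<oplus>\<^bsub>sections E U\<^esub> t) = ?\<phi> U s \<oplus>\<^bsub>sections (dual_sheaf T A F) U\<^esub> ?\<phi> U t"
      by (auto simp: dual_sheaf_def hom_sheaf_def regular_sheaf_def right_to_dual_def opens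
          E.restr_add pairing_add_right E.restr_closed intro!: restrict_ext)
  next
    fix U a s assume "openin T U" "a \<in> carrier (sections A U)" "s \<in> carrier (sections E U)"
    then show "?\<phi> U (a \<odot>\<^bsub>sections E U\<^esub> s) = a \<odot>\<^bsub>sections (dual_sheaf T A F) U\<^esub> ?\<phi> U s"
      by (auto simp: dual_sheaf_def hom_sheaf_def regular_sheaf_def right_to_dual_def opens
          E.restr_smult pairing_smult_right E.restr_closed F.A.restr_closed intro!: restrict_ext)
  next
    fix U V s assume "openin T U \<and> openin T V \<and> V \<subseteq> U" "s \<in> carrier (sections E U)"
    then show "?\<phi> V (restr E U V s) = restr (dual_sheaf T A F) U V (?\<phi> U s)"
      by (auto simp: dual_sheaf_def hom_sheaf_def right_to_dual_def opens E.restr_restr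
          restrict_def fun_eq_iff)
  qed
qed


lemma (in abelian_group) diff_eq_zero_iff:
  assumes "x \<in> carrier G" "y \<in> carrier G"
  shows "x \<ominus> y = \<zero> \<longleftrightarrow> x = y"
  using assms by (metis a_minus_def a_inv_closed minus_equality minus_minus r_neg)

lemma pairing_hom_right:
  assumes pair: "sheaf_pairing T A F E \<theta>" and E: "module_sheaf T A E"
    and U: "openin T U" and t: "t \<in> carrier (sections F U)"
  shows "abelian_group_hom (sections E U) (sections A U) (\<theta> U t)"
proof -
  interpret sheaf_pairing T A F E \<theta> by fact
  interpret E: module_sheaf T A E by fact
  have M: "module (sections A U) (sections E U)"
    using E.module_sections U .
  interpret MA: module "sections A U" "sections E U" by (rule M)
  show ?thesis
    using U t pairing_closed pairing_add_right
    by (intro abelian_group_homI group_hom.intro group_hom_axioms.intro homI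
        MA.R.abelian_group_axioms MA.M.abelian_group_axioms MA.R.a_group MA.M.a_group) auto
qed

lemma equal_values_iff_diff_annihilated:
  assumes "sheaf_pairing T A F E \<theta>" "module_sheaf T A E" "openin T U"
    and "t \<in> carrier (sections F U)" "s \<in> carrier (sections E U)" "s' \<in> carrier (sections E U)"
  shows "\<theta> U t (s \<ominus>\<^bsub>sections E U\<^esub> s') = \<zero>\<^bsub>sections A U\<^esub> \<longleftrightarrow> \<theta> U t s = \<theta> U t s'"
proof -
  interpret abelian_group_hom "sections E U" "sections A U" "\<theta> U t"
    using assms by (intro pairing_hom_right)
  show ?thesis
    using assms H.diff_eq_zero_iff[of "\<theta> U t s" "\<theta> U t s'"] by (simp add: a_minus_def)
qed

lemma submodule_orthogonal_in_right:
  assumes pair: "sheaf_pairing T A F E \<theta>" and E: "module_sheaf T A E"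
    and U: "openin T U" and sub: "F\<^sub>0 U \<subseteq> carrier (sections F U)"
  shows "submodule (orthogonal_in_right A E \<theta> F\<^sub>0 U) (sections A U) (sections E U)"
proof -
  interpret sheaf_pairing T A F E \<theta> by fact
  interpret E: module_sheaf T A E by fact
  interpret M: module "sections A U" "sections E U"
    using E.module_sections U .
  have hom: "abelian_group_hom (sections E U) (sections A U) (\<theta> U t)" if "t \<in> F\<^sub>0 U" for t
    using pairing_hom_right[OF pair E U] sub that by blast
  show ?thesis
    unfolding orthogonal_in_right_def
    using sub U
    by (intro M.submoduleI)
      (auto simp: abelian_group_hom.hom_zero[OF hom] abelian_group_hom.hom_a_inv[OF hom]
        pairing_add_right subset_iff pairing_smult_right)
qed

lemma orthogonal_in_left_swap:
  "orthogonal_in_left A F \<theta> E\<^sub>0 = orthogonal_in_right A F (\<lambda>U s t. \<theta> U t s) E\<^sub>0"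
  unfolding orthogonal_in_left_def orthogonal_in_right_def ..

text \<open>
  The situation common to both halves of the theorem: a pairing that vanishes on \<open>M\<close> and \<open>N\<close>, and hence
  descends to a pairing of \<open>M\<close> with \<open>E/N\<close>.
\<close>

locale annihilating_pairing = F: submodule_sheaf T A F M + E: submodule_sheaf T A E N +
    sheaf_pairing T A F E \<theta>
  for T :: "'x topology" and A :: "('x, complex, 'a) presheaf_data"
    and F :: "('x, 'a, 'f) presheaf_data" and M :: "'x set \<Rightarrow> 'f set"
    and E :: "('x, 'a, 'e) presheaf_data" and N :: "'x set \<Rightarrow> 'e set"
    and \<theta> :: "'x set \<Rightarrow> 'f \<Rightarrow> 'e \<Rightarrow> 'a" +
  assumes annihilates: "\<lbrakk>openin T U; t \<in> M U; s \<in> N U\<rbrakk> \<Longrightarrow> \<theta> U t s = \<zero>\<^bsub>sections A U\<^esub>"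
begin

lemmas values_eq_iff = equal_values_iff_diff_annihilated[OF sheaf_pairing_axioms E.module_sheaf_axioms]

text \<open>
  Lifts of one section differ locally by sections of \<open>N\<close>, which \<open>t\<close> annihilates, so the two values agree
  near every point.
\<close>

lemma value_independent_of_lift:
  assumes t: "t \<in> M V" and s: "lifts_to T E N V \<sigma> s" "lifts_to T E N V \<sigma> s'"
  shows "\<theta> V t s = \<theta> V t s'"
proof (rule F.A.section_eq_locally)
  show V: "openin T V"
    using s by (simp add: lifts_to_def)
  have sec: "s \<in> carrier (sections E V)" "s' \<in> carrier (sections E V)"
    using s by (auto simp: lifts_to_def)
  show "\<theta> V t s \<in> carrier (sections A V)" "\<theta> V t s' \<in> carrier (sections A V)"
    using V t sec F.sub_carrier pairing_closed by auto
  fix x assume "x \<in> V"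
  then obtain W where W: "openin T W" "x \<in> W" "W \<subseteq> V"
    and diff: "restr E V W s \<ominus>\<^bsub>sections E W\<^esub> restr E V W s' \<in> N W"
    using E.lifts_differ_locally[OF s] by blast
  have tW: "restr F V W t \<in> M W"
    using F.sub_restr_closed V W t by blast
  then have "\<theta> W (restr F V W t) (restr E V W s) = \<theta> W (restr F V W t) (restr E V W s')"
    using annihilates[OF W(1) tW diff] V W sec F.sub_carrier E.restr_closed
    by (simp add: values_eq_iff)
  then have "restr A V W (\<theta> V t s) = restr A V W (\<theta> V t s')"
    using V W t sec F.sub_carrier by (simp add: pairing_restr)
  with W show "\<exists>W. openin T W \<and> x \<in> W \<and> W \<subseteq> V \<and> restr A V W (\<theta> V t s) = restr A V W (\<theta> V t s')"
    by blast
qed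

text \<open>
  The characterisation of \<open>t\<sigma>\<close> by its restrictions, in a form with no choice of a cover: it must agree
  with the value of \<open>t\<close> on every lift of \<open>\<sigma>\<close> over every smaller open set.
\<close>

definition is_value :: "'x set \<Rightarrow> 'f \<Rightarrow> ('x \<Rightarrow> ('x set \<times> 'e set) set) \<Rightarrow> 'a \<Rightarrow> bool" where
  "is_value U t \<sigma> a \<longleftrightarrow> a \<in> carrier (sections A U) \<and>
    (\<forall>V s. V \<subseteq> U \<longrightarrow> lifts_to T E N V \<sigma> s \<longrightarrow> restr A U V a = \<theta> V (restr F U V t) s)"

definition quotient_pairing :: "'x set \<Rightarrow> 'f \<Rightarrow> ('x \<Rightarrow> ('x set \<times> 'e set) set) \<Rightarrow> 'a" where
  "quotient_pairing U t \<sigma> = (THE a. is_value U t \<sigma> a)"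

text \<open>
  Glue the values of \<open>t\<close> on one chosen lift over each open set that has a lift. These sets cover \<open>U\<close>, and
  the values on overlaps agree because they do not depend on the lift.
\<close>

lemma is_value_exists:
  assumes U: "openin T U" and t: "t \<in> M U" and \<sigma>: "\<sigma> \<in> carrier (sections E.Q U)"
  shows "\<exists>a. is_value U t \<sigma> a"
proof -
  define \<U> where "\<U> = {V. V \<subseteq> U \<and> (\<exists>s. lifts_to T E N V \<sigma> s)}"
  define lift where "lift V = (SOME s. lifts_to T E N V \<sigma> s)" for V
  define f where "f V = \<theta> V (restr F U V t) (lift V)" for V
  have un: "\<Union>\<U> = U"
    unfolding \<U>_def using E.lift_exists[OF \<sigma>] by blast
  have lift: "lifts_to T E N V \<sigma> (lift V)" and sub: "V \<subseteq> U" if "V \<in> \<U>" for V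
    using that someI_ex[of "lifts_to T E N V \<sigma>"] by (auto simp: \<U>_def lift_def)
  have op: "openin T V" and sec: "lift V \<in> carrier (sections E V)" if "V \<in> \<U>" for V
    using lift[OF that] by (auto simp: lifts_to_def)
  have tV: "restr F U V t \<in> M V" if "openin T V" "V \<subseteq> U" for V
    using F.sub_restr_closed U t that by blast
  have f_restr: "restr A V W (f V) = \<theta> W (restr F U W t) s"
    if V: "V \<in> \<U>" and W: "W \<subseteq> V" and s: "lifts_to T E N W \<sigma> s" for V W s
  proof -
    have oW: "openin T W"
      using s by (simp add: lifts_to_def)
    have "restr A V W (f V) = \<theta> W (restr F U W t) (restr E V W (lift V))"
      using op[OF V] oW W sub[OF V] sec[OF V] tV[of V] U t F.sub_carrier
      by (simp add: f_def pairing_restr F.restr_restr)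
    also have "\<dots> = \<theta> W (restr F U W t) s"
      using E.lifts_to_restr[OF lift[OF V] oW W] s tV[OF oW] W sub[OF V]
      by (intro value_independent_of_lift) auto
    finally show ?thesis .
  qed
  have "\<exists>a \<in> carrier (sections A (\<Union>\<U>)). \<forall>V\<in>\<U>. restr A (\<Union>\<U>) V a = f V"
  proof (rule F.A.gluing)
    show "openin T V" if "V \<in> \<U>" for V
      using op[OF that] .
    show "f V \<in> carrier (sections A V)" if "V \<in> \<U>" for V
      unfolding f_def using op[OF that] sec[OF that] tV sub[OF that] F.sub_carrier
      by (intro pairing_closed) auto
    show "restr A V (V \<inter> W) (f V) = restr A W (V \<inter> W) (f W)" if VW: "V \<in> \<U>" "W \<in> \<U>" for V W
    proof -
      have "lifts_to T E N (V \<inter> W) \<sigma> (restr E V (V \<inter> W) (lift V))"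
        using lift op VW by (intro E.lifts_to_restr) auto
      then show ?thesis
        using f_restr[OF VW(1), of "V \<inter> W"] f_restr[OF VW(2), of "V \<inter> W"] by simp
    qed
  qed
  then obtain a where a: "a \<in> carrier (sections A U)" and aV: "\<And>V. V \<in> \<U> \<Longrightarrow> restr A U V a = f V"
    unfolding un by blast
  have "restr A U V a = \<theta> V (restr F U V t) s" if "V \<subseteq> U" "lifts_to T E N V \<sigma> s" for V s
  proof -
    have V: "V \<in> \<U>"
      using that by (auto simp: \<U>_def)
    have "restr A V V (f V) = f V"
      using aV[OF V] a U op[OF V] \<open>V \<subseteq> U\<close> F.A.restr_restr[of U V V a] by simp
    then show ?thesis
      using f_restr[OF V _ that(2)] aV[OF V] by simp
  qed
  with a show ?thesis
    unfolding is_value_def by blast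
qed

lemma value_eqI:
  assumes U: "openin T U" and a: "is_value U t \<sigma> a"
    and b: "b \<in> carrier (sections A U)"
    and loc: "\<And>x. x \<in> U \<Longrightarrow> \<exists>V s. x \<in> V \<and> V \<subseteq> U \<and> lifts_to T E N V \<sigma> s \<and>
       restr A U V b = \<theta> V (restr F U V t) s"
  shows "b = a"
proof (rule F.A.section_eq_locally[OF U b])
  show "a \<in> carrier (sections A U)"
    using a by (simp add: is_value_def)
  fix x assume "x \<in> U"
  then show "\<exists>V. openin T V \<and> x \<in> V \<and> V \<subseteq> U \<and> restr A U V b = restr A U V a"
    using loc[of x] a unfolding is_value_def by (metis lifts_to_def)
qed

lemma is_value_quotient_pairing:
  assumes "openin T U" "t \<in> M U" "\<sigma> \<in> carrier (sections E.Q U)"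
  shows "is_value U t \<sigma> (quotient_pairing U t \<sigma>)"
  unfolding quotient_pairing_def
proof (rule theI')
  have "b = a" if "is_value U t \<sigma> a" "is_value U t \<sigma> b" for a b
    using value_eqI[OF assms(1) that(1), of b] that(2) E.lift_exists[OF assms(3)]
    unfolding is_value_def by meson
  then show "\<exists>!a. is_value U t \<sigma> a"
    using is_value_exists[OF assms] by blast
qed

lemma quotient_pairing_closed:
  assumes "openin T U" "t \<in> M U" "\<sigma> \<in> carrier (sections E.Q U)"
  shows "quotient_pairing U t \<sigma> \<in> carrier (sections A U)"
  using is_value_quotient_pairing[OF assms] by (simp add: is_value_def)

lemma quotient_pairing_lift:
  assumes "openin T U" "t \<in> M U" "\<sigma> \<in> carrier (sections E.Q U)"
    and "V \<subseteq> U" "lifts_to T E N V \<sigma> s"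
  shows "restr A U V (quotient_pairing U t \<sigma>) = \<theta> V (restr F U V t) s"
  using is_value_quotient_pairing[OF assms(1-3)] assms(4,5) by (simp add: is_value_def)

text \<open>
  A section that has the right restriction near each point is the value: one lift around each point is
  enough to identify it. Bilinearity and compatibility with restriction follow by checking them on lifts.
\<close>

lemma quotient_pairing_eqI:
  assumes "openin T U" "t \<in> M U" "\<sigma> \<in> carrier (sections E.Q U)" "b \<in> carrier (sections A U)"
    and "\<And>x. x \<in> U \<Longrightarrow> \<exists>V s. x \<in> V \<and> V \<subseteq> U \<and> lifts_to T E N V \<sigma> s \<and>
       restr A U V b = \<theta> V (restr F U V t) s"
  shows "quotient_pairing U t \<sigma> = b"
  using value_eqI[OF assms(1) is_value_quotient_pairing[OF assms(1-3)] assms(4,5)] by simp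

lemma quotient_pairing_section:
  assumes "openin T U" "t \<in> M U" "s \<in> carrier (sections E U)"
  shows "quotient_pairing U t (quotient_section T E N U s) = \<theta> U t s"
  using quotient_pairing_lift[OF assms(1,2) E.quotient_section_closed subset_refl
      E.lifts_to_quotient_section] assms F.sub_carrier quotient_pairing_closed
      E.quotient_section_closed
  by (simp add: F.restr_id F.A.restr_id)

lemma sheaf_pairing_quotient: "sheaf_pairing T A (subpresheaf F M) E.Q quotient_pairing"
proof
  fix U t \<sigma>
  assume U: "openin T U" and "t \<in> carrier (sections (subpresheaf F M) U)"
    and \<sigma>: "\<sigma> \<in> carrier (sections E.Q U)"
  then have t: "t \<in> M U"
    by (simp add: subpresheaf_def)
  let ?\<beta> = quotient_pairing
  have hom: "restr A U V \<in> ring_hom (sections A U) (sections A V)" if "openin T V" "V \<subseteq> U" for V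
    using F.A.restr_ring_hom U that .
  have Mod: "module (sections A U) (sections F U)" "submodule (M U) (sections A U) (sections F U)"
    using F.module_sections F.submodule_sections U by auto
  have cring: "cring (sections A U)"
    using Mod(1) by (simp add: module_def)
  note closed = quotient_pairing_closed[OF U]
  show "?\<beta> U t \<sigma> \<in> carrier (sections A U)"
    using closed t \<sigma> .
  show "?\<beta> U (t \<oplus>\<^bsub>sections (subpresheaf F M) U\<^esub> t') \<sigma> = ?\<beta> U t \<sigma> \<oplus>\<^bsub>sections A U\<^esub> ?\<beta> U t' \<sigma>"
    if "t' \<in> carrier (sections (subpresheaf F M) U)" for t'
  proof -
    have t': "t' \<in> M U"
      using that by (simp add: subpresheaf_def)
    have "?\<beta> U (t \<oplus>\<^bsub>sections F U\<^esub> t') \<sigma> = ?\<beta> U t \<sigma> \<oplus>\<^bsub>sections A U\<^esub> ?\<beta> U t' \<sigma>"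
    proof (rule quotient_pairing_eqI[OF U _ \<sigma>])
      show "t \<oplus>\<^bsub>sections F U\<^esub> t' \<in> M U"
        using module.submoduleE(5)[OF Mod t t'] .
      show "?\<beta> U t \<sigma> \<oplus>\<^bsub>sections A U\<^esub> ?\<beta> U t' \<sigma> \<in> carrier (sections A U)"
        using closed t t' \<sigma> cring by (simp add: cring.cring_simprules)
      fix x assume "x \<in> U"
      then obtain V s where V: "x \<in> V" "V \<subseteq> U" "lifts_to T E N V \<sigma> s"
        using E.lift_exists[OF \<sigma>] by blast
      moreover have "restr A U V (?\<beta> U t \<sigma> \<oplus>\<^bsub>sections A U\<^esub> ?\<beta> U t' \<sigma>) =
          \<theta> V (restr F U V (t \<oplus>\<^bsub>sections F U\<^esub> t')) s"
        using V lifts_toD[OF V(3)] U t t' \<sigma> ring_hom_add[OF hom[of V]] closed F.sub_carrier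
        by (simp add: quotient_pairing_lift F.restr_add pairing_add_left
            F.restr_closed)
      ultimately show "\<exists>V s. x \<in> V \<and> V \<subseteq> U \<and> lifts_to T E N V \<sigma> s \<and>
          restr A U V (?\<beta> U t \<sigma> \<oplus>\<^bsub>sections A U\<^esub> ?\<beta> U t' \<sigma>) =
          \<theta> V (restr F U V (t \<oplus>\<^bsub>sections F U\<^esub> t')) s"
        by blast
    qed
    then show ?thesis
      by (simp add: subpresheaf_def)
  qed
  show "?\<beta> U (a \<odot>\<^bsub>sections (subpresheaf F M) U\<^esub> t) \<sigma> = a \<otimes>\<^bsub>sections A U\<^esub> ?\<beta> U t \<sigma>"
    if a: "a \<in> carrier (sections A U)" for a
  proof -
    have "?\<beta> U (a \<odot>\<^bsub>sections F U\<^esub> t) \<sigma> = a \<otimes>\<^bsub>sections A U\<^esub> ?\<beta> U t \<sigma>"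
    proof (rule quotient_pairing_eqI[OF U _ \<sigma>])
      show "a \<odot>\<^bsub>sections F U\<^esub> t \<in> M U"
        using module.submoduleE(4)[OF Mod a t] .
      show "a \<otimes>\<^bsub>sections A U\<^esub> ?\<beta> U t \<sigma> \<in> carrier (sections A U)"
        using closed t \<sigma> a cring by (simp add: cring.cring_simprules)
      fix x assume "x \<in> U"
      then obtain V s where V: "x \<in> V" "V \<subseteq> U" "lifts_to T E N V \<sigma> s"
        using E.lift_exists[OF \<sigma>] by blast
      moreover have "restr A U V (a \<otimes>\<^bsub>sections A U\<^esub> ?\<beta> U t \<sigma>) =
          \<theta> V (restr F U V (a \<odot>\<^bsub>sections F U\<^esub> t)) s"
        using V lifts_toD[OF V(3)] U t \<sigma> a ring_hom_mult[OF hom[of V]] closed F.sub_carrier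
        by (simp add: quotient_pairing_lift F.restr_smult
            pairing_smult_left F.restr_closed F.A.restr_closed)
      ultimately show "\<exists>V s. x \<in> V \<and> V \<subseteq> U \<and> lifts_to T E N V \<sigma> s \<and>
          restr A U V (a \<otimes>\<^bsub>sections A U\<^esub> ?\<beta> U t \<sigma>) =
          \<theta> V (restr F U V (a \<odot>\<^bsub>sections F U\<^esub> t)) s"
        by blast
    qed
    then show ?thesis
      by (simp add: subpresheaf_def)
  qed
  show "?\<beta> U t (\<sigma> \<oplus>\<^bsub>sections E.Q U\<^esub> \<tau>) = ?\<beta> U t \<sigma> \<oplus>\<^bsub>sections A U\<^esub> ?\<beta> U t \<tau>"
    if \<tau>: "\<tau> \<in> carrier (sections E.Q U)" for \<tau>
  proof (rule quotient_pairing_eqI[OF U t])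
    show "\<sigma> \<oplus>\<^bsub>sections E.Q U\<^esub> \<tau> \<in> carrier (sections E.Q U)"
      using E.quotient.add_closed U \<sigma> \<tau> .
    show "?\<beta> U t \<sigma> \<oplus>\<^bsub>sections A U\<^esub> ?\<beta> U t \<tau> \<in> carrier (sections A U)"
      using closed t \<tau> \<sigma> cring by (simp add: cring.cring_simprules)
    fix x assume "x \<in> U"
    then obtain V s s' where V: "x \<in> V" "V \<subseteq> U" "lifts_to T E N V \<sigma> s" "lifts_to T E N V \<tau> s'"
      using E.common_lift[OF \<sigma> \<tau> \<open>x \<in> U\<close>] by meson
    have "restr A U V (?\<beta> U t \<sigma> \<oplus>\<^bsub>sections A U\<^esub> ?\<beta> U t \<tau>) =
        \<theta> V (restr F U V t) (s \<oplus>\<^bsub>sections E V\<^esub> s')"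
      using V lifts_toD[OF V(3)] lifts_toD[OF V(4)] U t \<sigma> \<tau> ring_hom_add[OF hom[of V]]
        closed F.sub_carrier
      by (simp add: quotient_pairing_lift pairing_add_right F.restr_closed)
    then show "\<exists>V s. x \<in> V \<and> V \<subseteq> U \<and> lifts_to T E N V (\<sigma> \<oplus>\<^bsub>sections E.Q U\<^esub> \<tau>) s \<and>
        restr A U V (?\<beta> U t \<sigma> \<oplus>\<^bsub>sections A U\<^esub> ?\<beta> U t \<tau>) = \<theta> V (restr F U V t) s"
      using V(1,2) E.lifts_to_add[OF V(3,4,2)] by metis
  qed
  show "?\<beta> U t (a \<odot>\<^bsub>sections E.Q U\<^esub> \<sigma>) = a \<otimes>\<^bsub>sections A U\<^esub> ?\<beta> U t \<sigma>"
    if a: "a \<in> carrier (sections A U)" for a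
  proof (rule quotient_pairing_eqI[OF U t])
    show "a \<odot>\<^bsub>sections E.Q U\<^esub> \<sigma> \<in> carrier (sections E.Q U)"
      using E.quotient.smult_closed U a \<sigma> .
    show "a \<otimes>\<^bsub>sections A U\<^esub> ?\<beta> U t \<sigma> \<in> carrier (sections A U)"
      using closed t \<sigma> a cring by (simp add: cring.cring_simprules)
    fix x assume "x \<in> U"
    then obtain V s where V: "x \<in> V" "V \<subseteq> U" "lifts_to T E N V \<sigma> s"
      using E.lift_exists[OF \<sigma>] by blast
    have "restr A U V (a \<otimes>\<^bsub>sections A U\<^esub> ?\<beta> U t \<sigma>) =
        \<theta> V (restr F U V t) (restr A U V a \<odot>\<^bsub>sections E V\<^esub> s)"
      using V lifts_toD[OF V(3)] U t \<sigma> a ring_hom_mult[OF hom[of V]] closed F.sub_carrier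
      by (simp add: quotient_pairing_lift pairing_smult_right
          F.restr_closed F.A.restr_closed)
    then show "\<exists>V s. x \<in> V \<and> V \<subseteq> U \<and> lifts_to T E N V (a \<odot>\<^bsub>sections E.Q U\<^esub> \<sigma>) s \<and>
        restr A U V (a \<otimes>\<^bsub>sections A U\<^esub> ?\<beta> U t \<sigma>) = \<theta> V (restr F U V t) s"
      using V(1,2) E.lifts_to_smult[OF U V(3,2) a] by metis
  qed
  show "restr A U V (?\<beta> U t \<sigma>) = ?\<beta> V (restr (subpresheaf F M) U V t) (restr E.Q U V \<sigma>)"
    if V: "openin T V" "V \<subseteq> U" for V
  proof -
    have "?\<beta> V (restr F U V t) (restr E.Q U V \<sigma>) = restr A U V (?\<beta> U t \<sigma>)"
    proof (rule quotient_pairing_eqI[OF V(1)])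
      show "restr F U V t \<in> M V"
        using F.sub_restr_closed U V t by blast
      show \<sigma>V: "restr E.Q U V \<sigma> \<in> carrier (sections E.Q V)"
        using E.quotient.restr_closed U V \<sigma> .
      show "restr A U V (?\<beta> U t \<sigma>) \<in> carrier (sections A V)"
        using F.A.restr_closed U V closed t \<sigma> by blast
      fix x assume "x \<in> V"
      then obtain W s where W: "x \<in> W" "W \<subseteq> V" "lifts_to T E N W (restr E.Q U V \<sigma>) s"
        using E.lift_exists[OF \<sigma>V] by blast
      have oW: "openin T W"
        using W(3) by (simp add: lifts_to_def)
      have "lifts_to T E N W \<sigma> s"
        using W by (simp add: quotient_sheaf_simps(1) E.lifts_to_restrict)
      then have "restr A V W (restr A U V (?\<beta> U t \<sigma>)) = \<theta> W (restr F V W (restr F U V t)) s"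
        using U V W oW t \<sigma> closed F.sub_carrier quotient_pairing_lift[OF U t \<sigma>, of W s]
        by (simp add: F.A.restr_restr F.restr_restr)
      with W show "\<exists>W s. x \<in> W \<and> W \<subseteq> V \<and> lifts_to T E N W (restr E.Q U V \<sigma>) s \<and>
          restr A V W (restr A U V (?\<beta> U t \<sigma>)) = \<theta> W (restr F V W (restr F U V t)) s"
        by blast
    qed
    then show ?thesis
      by (simp add: subpresheaf_def)
  qed
qed

text \<open>
  Two sections of \<open>E/N\<close> with the same induced map have common local lifts \<open>s\<close>, \<open>s'\<close> on which every
  \<open>t \<in> M(V)\<close> takes the same value. The difference \<open>s - s'\<close> is then orthogonal to \<open>M(V)\<close>, hence in \<open>N(V)\<close>.
\<close>

lemma right_to_dual_injective:
  assumes orth: "\<And>U. openin T U \<Longrightarrow> orthogonal_in_right A E \<theta> M U \<subseteq> N U"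
  shows "injective_sheaf_morphism T A E.Q (dual_sheaf T A (subpresheaf F M))
    (right_to_dual T (subpresheaf F M) E.Q quotient_pairing)"
  unfolding injective_sheaf_morphism_def
proof (intro conjI allI impI inj_onI)
  show "sheaf_morphism T A E.Q (dual_sheaf T A (subpresheaf F M))
      (right_to_dual T (subpresheaf F M) E.Q quotient_pairing)"
    using sheaf_pairing_quotient F.presheaf_of_modules_sub E.quotient.presheaf_of_modules_axioms
    by (rule right_to_dual_morphism)
  fix U \<sigma> \<tau>
  assume U: "openin T U" and \<sigma>: "\<sigma> \<in> carrier (sections E.Q U)"
    and \<tau>: "\<tau> \<in> carrier (sections E.Q U)"
    and eq: "right_to_dual T (subpresheaf F M) E.Q quotient_pairing U \<sigma> =
      right_to_dual T (subpresheaf F M) E.Q quotient_pairing U \<tau>"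
  have vals: "quotient_pairing V t (restr E.Q U V \<sigma>) = quotient_pairing V t (restr E.Q U V \<tau>)"
    if V: "openin T V" "V \<subseteq> U" and t: "t \<in> M V" for V t
  proof -
    have "right_to_dual T (subpresheaf F M) E.Q quotient_pairing U \<rho> V t =
        quotient_pairing V t (restr E.Q U V \<rho>)" for \<rho>
      using V t U by (simp add: right_to_dual_def subpresheaf_def openin_open_subtopology)
    then show ?thesis
      using eq by metis
  qed
  show "\<sigma> = \<tau>"
  proof (rule extensionalityI[of _ U])
    show "\<sigma> \<in> extensional U" "\<tau> \<in> extensional U"
      using \<sigma> \<tau> by (auto simp: E.carrier_quotient_sheaf)
    fix x assume "x \<in> U"
    then obtain V s s' where V: "x \<in> V" "V \<subseteq> U"
      and lifts: "lifts_to T E N V \<sigma> s" "lifts_to T E N V \<tau> s'"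
      using E.common_lift[OF \<sigma> \<tau> \<open>x \<in> U\<close>] by meson
    then have oV: "openin T V" and sec: "s \<in> carrier (sections E V)" "s' \<in> carrier (sections E V)"
      by (auto simp: lifts_to_def)
    have restr_V: "quotient_pairing V t (restr E.Q U V \<rho>) = \<theta> V t r"
      if t: "t \<in> M V" and \<rho>: "\<rho> \<in> carrier (sections E.Q U)" and r: "lifts_to T E N V \<rho> r"
      for t \<rho> r
    proof -
      have \<rho>V: "restr E.Q U V \<rho> \<in> carrier (sections E.Q V)"
        using E.quotient.restr_closed U oV V(2) \<rho> .
      have "lifts_to T E N V (restr E.Q U V \<rho>) r"
        using r by (simp add: quotient_sheaf_simps(1) E.lifts_to_restrict)
      from quotient_pairing_lift[OF oV t \<rho>V subset_refl this] show ?thesis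
        using oV t quotient_pairing_closed[OF oV t \<rho>V] F.sub_carrier
        by (simp add: F.restr_id F.A.restr_id)
    qed
    have "\<theta> V t s = \<theta> V t s'" if t: "t \<in> M V" for t
      using vals[OF oV V(2) t] restr_V[OF t \<sigma> lifts(1)] restr_V[OF t \<tau> lifts(2)] by simp
    then have "\<theta> V t (s \<ominus>\<^bsub>sections E V\<^esub> s') = \<zero>\<^bsub>sections A V\<^esub>" if "t \<in> M V" for t
      using that oV sec F.sub_carrier by (simp add: values_eq_iff)
    then have "s \<ominus>\<^bsub>sections E V\<^esub> s' \<in> orthogonal_in_right A E \<theta> M V"
      using sec E.module_sections[OF oV] by (simp add: orthogonal_in_right_def module_def
          abelian_group.minus_closed)
    then have "s \<ominus>\<^bsub>sections E V\<^esub> s' \<in> N V"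
      using orth[OF oV] by blast
    then show "\<sigma> x = \<tau> x"
      using E.lifts_to_diff[OF lifts] V(1) by blast
  qed
qed

text \<open>
  It suffices to evaluate the two maps on classes of sections of \<open>E\<close> over the whole of \<open>U\<close>: there the
  induced pairing is the given one, whose left kernel vanishes.
\<close>

lemma left_to_dual_injective:
  assumes kernel: "\<And>U. openin T U \<Longrightarrow> left_kernel A F E \<theta> U = {\<zero>\<^bsub>sections F U\<^esub>}"
  shows "injective_sheaf_morphism T A (subpresheaf F M) (dual_sheaf T A E.Q)
    (left_to_dual T (subpresheaf F M) E.Q quotient_pairing)"
  unfolding injective_sheaf_morphism_def
proof (intro conjI allI impI inj_onI)
  show "sheaf_morphism T A (subpresheaf F M) (dual_sheaf T A E.Q)
      (left_to_dual T (subpresheaf F M) E.Q quotient_pairing)"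
    unfolding left_to_dual_swap
    using sheaf_pairing_swap[OF sheaf_pairing_quotient] E.quotient.presheaf_of_modules_axioms
      F.presheaf_of_modules_sub by (rule right_to_dual_morphism)
  fix U t t'
  assume U: "openin T U" and "t \<in> carrier (sections (subpresheaf F M) U)"
    and "t' \<in> carrier (sections (subpresheaf F M) U)"
    and eq: "left_to_dual T (subpresheaf F M) E.Q quotient_pairing U t =
      left_to_dual T (subpresheaf F M) E.Q quotient_pairing U t'"
  then have t: "t \<in> M U" and t': "t' \<in> M U"
    by (simp_all add: subpresheaf_def)
  then have sec: "t \<in> carrier (sections F U)" "t' \<in> carrier (sections F U)"
    using F.sub_carrier U by auto
  interpret M: module "sections A U" "sections F U"
    using F.module_sections U .
  have val: "left_to_dual T (subpresheaf F M) E.Q quotient_pairing U r U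
      (quotient_section T E N U s) = \<theta> U r s"
    if "r \<in> M U" "s \<in> carrier (sections E U)" for r s
    using that U E.quotient_section_closed[OF U]
    by (simp add: left_to_dual_def subpresheaf_def openin_open_subtopology quotient_pairing_section
        F.restr_id F.sub_carrier)
  have "\<theta> U t s = \<theta> U t' s" if "s \<in> carrier (sections E U)" for s
    using val[OF t that] val[OF t' that] eq by simp
  then have "\<theta> U (t \<ominus>\<^bsub>sections F U\<^esub> t') s = \<zero>\<^bsub>sections A U\<^esub>"
    if "s \<in> carrier (sections E U)" for s
    using equal_values_iff_diff_annihilated[OF sheaf_pairing_swap[OF sheaf_pairing_axioms]
      F.module_sheaf_axioms U that sec] that by simp
  then have "t \<ominus>\<^bsub>sections F U\<^esub> t' \<in> left_kernel A F E \<theta> U"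
    using sec by (simp add: left_kernel_def orthogonal_in_left_def)
  then have "t \<ominus>\<^bsub>sections F U\<^esub> t' = \<zero>\<^bsub>sections F U\<^esub>"
    using kernel[OF U] by simp
  then show "t = t'"
    using sec by (simp add: M.diff_eq_zero_iff)
qed

end

section \<open>The induced maps into the duals\<close>

theorem theorem2p3:
  fixes T :: "'x topology"
    and A :: "('x, complex, 'a) presheaf_data"
    and F :: "('x, 'a, 'f) presheaf_data"
    and E :: "('x, 'a, 'e) presheaf_data"
    and \<theta> :: "'x set \<Rightarrow> 'f \<Rightarrow> 'e \<Rightarrow> 'a"
    and F\<^sub>0 :: "'x set \<Rightarrow> 'f set"
    and E\<^sub>0 :: "'x set \<Rightarrow> 'e set"
  defines "F\<^sub>0_perp \<equiv> orthogonal_in_right A E \<theta> F\<^sub>0"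
    and "E\<^sub>0_perp \<equiv> orthogonal_in_left A F \<theta> E\<^sub>0"
  assumes "algebra_sheaf T A"
    and "module_sheaf T A F"
    and "module_sheaf T A E"
    and "sheaf_pairing T A F E \<theta>"
    and "\<And>U. openin T U \<Longrightarrow> left_kernel A F E \<theta> U = {\<zero>\<^bsub>sections F U\<^esub>}"
    and "submodule_sheaf T A F F\<^sub>0"
    and "submodule_sheaf T A E E\<^sub>0"
    and "sheaf T (subpresheaf E F\<^sub>0_perp)"
    and "sheaf T (subpresheaf F E\<^sub>0_perp)"
  shows
    "(\<exists>\<beta>. sheaf_pairing T A (subpresheaf F F\<^sub>0) (quotient_sheaf T A E F\<^sub>0_perp) \<beta> \<and>
        (\<forall>U t s. openin T U \<longrightarrow> t \<in> F\<^sub>0 U \<longrightarrow> s \<in> carrier (sections E U) \<longrightarrow>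
          \<beta> U t (quotient_section T E F\<^sub>0_perp U s) = \<theta> U t s) \<and>
        injective_sheaf_morphism T A
          (quotient_sheaf T A E F\<^sub>0_perp)
          (dual_sheaf T A (subpresheaf F F\<^sub>0))
          (right_to_dual T (subpresheaf F F\<^sub>0) (quotient_sheaf T A E F\<^sub>0_perp) \<beta>)) \<and>
     (\<exists>\<gamma>. sheaf_pairing T A (subpresheaf F E\<^sub>0_perp) (quotient_sheaf T A E E\<^sub>0) \<gamma> \<and>
        (\<forall>U t s. openin T U \<longrightarrow> t \<in> E\<^sub>0_perp U \<longrightarrow> s \<in> carrier (sections E U) \<longrightarrow>
          \<gamma> U t (quotient_section T E E\<^sub>0 U s) = \<theta> U t s) \<and>
        injective_sheaf_morphism T A
          (subpresheaf F E\<^sub>0_perp)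
          (dual_sheaf T A (quotient_sheaf T A E E\<^sub>0))
          (left_to_dual T (subpresheaf F E\<^sub>0_perp) (quotient_sheaf T A E E\<^sub>0) \<gamma>))"
proof -
  interpret F\<^sub>0: submodule_sheaf T A F F\<^sub>0 by fact
  interpret E\<^sub>0: submodule_sheaf T A E E\<^sub>0 by fact
  have pairing: "sheaf_pairing T A F E \<theta>" by fact
  have "submodule (F\<^sub>0_perp U) (sections A U) (sections E U)" if "openin T U" for U
    unfolding F\<^sub>0_perp_def using that F\<^sub>0.sub_carrier
    by (intro submodule_orthogonal_in_right[OF pairing E\<^sub>0.module_sheaf_axioms]) blast+
  then have F\<^sub>0_perp: "submodule_sheaf T A E F\<^sub>0_perp"
    using assms(10)
    by (intro submodule_sheaf.intro E\<^sub>0.module_sheaf_axioms submodule_sheaf_axioms.intro)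
  have "submodule (E\<^sub>0_perp U) (sections A U) (sections F U)" if "openin T U" for U
    unfolding E\<^sub>0_perp_def orthogonal_in_left_swap using that E\<^sub>0.sub_carrier
    by (intro submodule_orthogonal_in_right[OF sheaf_pairing_swap[OF pairing]
          F\<^sub>0.module_sheaf_axioms]) blast+
  then have E\<^sub>0_perp: "submodule_sheaf T A F E\<^sub>0_perp"
    using assms(11)
    by (intro submodule_sheaf.intro F\<^sub>0.module_sheaf_axioms submodule_sheaf_axioms.intro)
  interpret right: annihilating_pairing T A F F\<^sub>0 E F\<^sub>0_perp \<theta>
    by (intro annihilating_pairing.intro F\<^sub>0.submodule_sheaf_axioms F\<^sub>0_perp pairing
        annihilating_pairing_axioms.intro)
      (simp add: F\<^sub>0_perp_def orthogonal_in_right_def)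
  interpret left: annihilating_pairing T A F E\<^sub>0_perp E E\<^sub>0 \<theta>
    by (intro annihilating_pairing.intro E\<^sub>0.submodule_sheaf_axioms E\<^sub>0_perp pairing
        annihilating_pairing_axioms.intro)
      (simp add: E\<^sub>0_perp_def orthogonal_in_left_def)
  show ?thesis
    using right.sheaf_pairing_quotient right.quotient_pairing_section right.right_to_dual_injective
      left.sheaf_pairing_quotient left.quotient_pairing_section left.left_to_dual_injective
      assms(7) F\<^sub>0_perp_def
    by (intro conjI exI[of _ right.quotient_pairing] exI[of _ left.quotient_pairing]) auto
qed

end
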